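(* Let $A_\Gamma$ be a locally reducible Artin group such that $\widehat\Gamma$ has at least two connected components. Then any parabolic subgroup $P$ of $A_\Gamma$ which has a 2-completion that is not all of $A_\Gamma$ is weakly malnormal in $A_\Gamma$, i.e., there exists $g\in A_\Gamma$ such that $|P\cap gPg^{-1}|<\infty$.
   Context: **Artin groups.** Let $S=\{s_1,\dots,s_n\}$ be a finite set and let $m_{ij}=m_{ji}\in\{2,3,\dots,\infty\}$ for $i\neq j$. The Artin group is $\langle s_1,\dots,s_n \mid s_is_js_i\cdots = s_js_is_j\cdots \ (m_{ij}\text{ letters on each side, for } m_{ij}<\infty)\rangle$; there is no relation when $m_{ij}=\infty$. The defining graph $\Gamma$ has vertex set $V(\Gamma)=S$ and an edge labeled $m_{ij}$ between $s_i$ and $s_j$ whenever $m_{ij}<\infty$; the group is denoted $A_\Gamma$. The Coxeter group $W_\Gamma$ is the quotient of $A_\Gamma$ by the relations $s_i^2=1$. $A_\Gamma$ is of finite type if $W_\Gamma$ is finite. **Parabolic subgroups.** For $T\subseteq S$, $A_T$ denotes the subgroup of $A_\Gamma$ generated by $T$ (a standard parabolic subgroup; $A_\emptyset=\{1\}$); it is naturally the Artin group on the full subgraph of $\Gamma$ spanned by $T$. A parabolic subgroup is a conjugate $gA_Tg^{-1}$ of a standard one. **Locally reducible.** $A_\Gamma$ is locally reducible if the only finite type triangles contained in $\Gamma$ are of the form $2$-$2$-$k$, $k\ge2$; that is, whenever three distinct vertices of $\Gamma$ are pairwise joined by edges and generate a finite type Artin group, at least two of the three edge labels are $2$. **2-completions.**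 $\widehat\Gamma$ is the graph obtained from $\Gamma$ by deleting all edges not labeled $2$ (keeping all vertices; an isolated vertex is its own connected component). A parabolic subgroup of $A_\Gamma$ is 2-complete if it can be written as $gA_Tg^{-1}$ with $g\in A_\Gamma$ and $T\subseteq V(\Gamma)$ a union of (vertex sets of) connected components of $\widehat\Gamma$. A 2-completion of a parabolic subgroup $P$ is a 2-complete parabolic subgroup of $A_\Gamma$ containing $P$ (2-completions are not unique). *)

theory Defs
  imports "HOL-Algebra.Generated_Groups" "HOL-Library.Extended_Nat"
begin

section \<open>Groups given by generators and relations\<close>

text \<open>The letter \<open>(s, True)\<close> stands for \<open>s\<close>, the letter \<open>(s, False)\<close> for its inverse.
  A relation \<open>u = v\<close> is a pair of words \<open>(u, v)\<close>.\<close>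

type_synonym 'a word = "('a \<times> bool) list"

definition words :: "'a set \<Rightarrow> 'a word set" where
  "words X = lists (X \<times> UNIV)"

inductive_set pres_rel :: "'a set \<Rightarrow> ('a word \<times> 'a word) set \<Rightarrow> ('a word \<times> 'a word) set"
  for X :: "'a set" and R :: "('a word \<times> 'a word) set" where
    base: "(u, v) \<in> R \<Longrightarrow> u \<in> words X \<Longrightarrow> v \<in> words X \<Longrightarrow> (u, v) \<in> pres_rel X R"
  | cancel: "s \<in> X \<Longrightarrow> ([(s, b), (s, \<not> b)], []) \<in> pres_rel X R"
  | refl: "u \<in> words X \<Longrightarrow> (u, u) \<in> pres_rel X R"
  | sym: "(u, v) \<in> pres_rel X R \<Longrightarrow> (v, u) \<in> pres_rel X R"
  | trans: "(u, v) \<in> pres_rel X R \<Longrightarrow> (v, w) \<in> pres_rel X R \<Longrightarrow> (u, w) \<in> pres_rel X R"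
  | append: "(u, v) \<in> pres_rel X R \<Longrightarrow> (u', v') \<in> pres_rel X R
      \<Longrightarrow> (u @ u', v @ v') \<in> pres_rel X R"

definition presented_group :: "'a set \<Rightarrow> ('a word \<times> 'a word) set \<Rightarrow> 'a word set monoid" where
  "presented_group X R =
     \<lparr>carrier = words X // pres_rel X R,
      mult = (\<lambda>A B. \<Union>u\<in>A. \<Union>v\<in>B. pres_rel X R `` {u @ v}),
      one = pres_rel X R `` {[]}\<rparr>"

definition pres_gen :: "'a set \<Rightarrow> ('a word \<times> 'a word) set \<Rightarrow> 'a \<Rightarrow> 'a word set" where
  "pres_gen X R s = pres_rel X R `` {[(s, True)]}"

lemma pres_rel_words: "(u, v) \<in> pres_rel X R \<Longrightarrow> u \<in> words X \<and> v \<in> words X"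
  by (induction rule: pres_rel.induct) (auto simp: words_def)

lemma equiv_pres_rel: "equiv (words X) (pres_rel X R)"
  by (rule equivI)
     (auto simp: refl_on_def sym_def trans_def dest: pres_rel_words
       intro: pres_rel.refl pres_rel.sym pres_rel.trans)

lemma congruent2_pres_rel:
  "congruent2 (pres_rel X R) (pres_rel X R) (\<lambda>u v. pres_rel X R `` {u @ v})"
  unfolding congruent2_def
  by (auto intro!: equiv_class_eq[OF equiv_pres_rel] pres_rel.append)

lemma presented_group_mult:
  assumes "u \<in> words X" "v \<in> words X"
  shows "(pres_rel X R `` {u}) \<otimes>\<^bsub>presented_group X R\<^esub> (pres_rel X R `` {v})
    = pres_rel X R `` {u @ v}"
  using UN_equiv_class2[OF equiv_pres_rel equiv_pres_rel congruent2_pres_rel assms]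
  by (simp add: presented_group_def)

lemma pres_rel_inverse:
  "u \<in> words X \<Longrightarrow> (rev (map (\<lambda>(s, b). (s, \<not> b)) u) @ u, []) \<in> pres_rel X R"
proof (induction u)
  case Nil
  then show ?case by (simp add: pres_rel.refl)
next
  case (Cons a u)
  obtain s b where a: "a = (s, b)" by (cases a)
  define w where "w = rev (map (\<lambda>(s, b). (s, \<not> b)) u)"
  have s: "s \<in> X" and u: "u \<in> words X" using Cons.prems by (auto simp: words_def a)
  then have w: "w \<in> words X" by (force simp: words_def w_def in_lists_conv_set)
  have "([(s, \<not> b), (s, b)], []) \<in> pres_rel X R"
    using pres_rel.cancel[OF s, of "\<not> b" R] by simp
  from pres_rel.append[OF pres_rel.refl[OF w] pres_rel.append[OF this pres_rel.refl[OF u]]]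
  have "(w @ [(s, \<not> b), (s, b)] @ u, w @ u) \<in> pres_rel X R" by simp
  from pres_rel.trans[OF this] Cons.IH[OF u] show ?case by (simp add: a w_def)
qed

lemma group_presented_group: "group (presented_group X R)" (is "group ?G")
proof (rule groupI)
  have app: "u @ v \<in> words X" if "u \<in> words X" "v \<in> words X" for u v
    using that by (simp add: words_def)
  have nil: "[] \<in> words X" by (simp add: words_def)
  have carr: "carrier ?G = words X // pres_rel X R"
    and one: "\<one>\<^bsub>?G\<^esub> = pres_rel X R `` {[]}"
    by (simp_all add: presented_group_def)
  show "\<one>\<^bsub>?G\<^esub> \<in> carrier ?G"
    unfolding carr one by (intro quotientI nil)
  show "x \<otimes>\<^bsub>?G\<^esub> y \<in> carrier ?G" if "x \<in> carrier ?G" "y \<in> carrier ?G" for x y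
    using that unfolding carr
    by (elim quotientE) (simp add: presented_group_mult quotientI app)
  show "x \<otimes>\<^bsub>?G\<^esub> y \<otimes>\<^bsub>?G\<^esub> z = x \<otimes>\<^bsub>?G\<^esub> (y \<otimes>\<^bsub>?G\<^esub> z)"
    if "x \<in> carrier ?G" "y \<in> carrier ?G" "z \<in> carrier ?G" for x y z
    using that unfolding carr
    by (elim quotientE) (simp add: presented_group_mult app)
  show "\<one>\<^bsub>?G\<^esub> \<otimes>\<^bsub>?G\<^esub> x = x" if "x \<in> carrier ?G" for x
    using that unfolding carr one
    by (elim quotientE) (simp add: presented_group_mult nil)
  show "\<exists>y\<in>carrier ?G. y \<otimes>\<^bsub>?G\<^esub> x = \<one>\<^bsub>?G\<^esub>" if xG: "x \<in> carrier ?G" for x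
  proof -
    obtain u where x: "x = pres_rel X R `` {u}" and u: "u \<in> words X"
      using xG unfolding carr by (auto elim: quotientE)
    let ?v = "rev (map (\<lambda>(s, b). (s, \<not> b)) u)"
    have v: "?v \<in> words X" using u by (force simp: words_def in_lists_conv_set)
    have "pres_rel X R `` {?v} \<otimes>\<^bsub>?G\<^esub> x = \<one>\<^bsub>?G\<^esub>"
      unfolding x presented_group_mult[OF v u] one
      by (rule equiv_class_eq[OF equiv_pres_rel pres_rel_inverse[OF u]])
    then show ?thesis unfolding carr using v by (blast intro: quotientI)
  qed
qed

definition normal_closure :: "('g, 'b) monoid_scheme \<Rightarrow> 'g set \<Rightarrow> 'g set" where
  "normal_closure G A = \<Inter>{N. N \<lhd> G \<and> A \<subseteq> N}"

lemma (in group) normal_closure_normal: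
  assumes "A \<subseteq> carrier G"
  shows "normal_closure G A \<lhd> G"
proof -
  let ?N = "{N. N \<lhd> G \<and> A \<subseteq> N}"
  have "carrier G \<lhd> G" by (auto simp: normal_inv_iff subgroup_self)
  then have ne: "?N \<noteq> {}" using assms by blast
  have "subgroup (\<Inter>?N) G"
    by (rule subgroups_Inter[OF _ ne]) (simp add: normal_inv_iff)
  then show ?thesis unfolding normal_closure_def by (auto simp: normal_inv_iff)
qed

definition conj_subset :: "('g, 'b) monoid_scheme \<Rightarrow> 'g \<Rightarrow> 'g set \<Rightarrow> 'g set" where
  "conj_subset G g H = g <#\<^bsub>G\<^esub> (H #>\<^bsub>G\<^esub> (inv\<^bsub>G\<^esub> g))"

definition weakly_malnormal :: "('g, 'b) monoid_scheme \<Rightarrow> 'g set \<Rightarrow> bool" where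
  "weakly_malnormal G H \<longleftrightarrow> (\<exists>g\<in>carrier G. finite (H \<inter> conj_subset G g H))"


section \<open>Artin and Coxeter groups\<close>

text \<open>The defining graph is given by its vertex set \<open>V\<close> and the labels \<open>m\<close>; the label
  \<open>\<infinity>\<close> means that there is no edge. The values \<open>m s s\<close> and the values of \<open>m\<close> outside \<open>V\<close>
  are never used.\<close>

definition artin_labels :: "'a set \<Rightarrow> ('a \<Rightarrow> 'a \<Rightarrow> enat) \<Rightarrow> bool" where
  "artin_labels V m \<longleftrightarrow>
     finite V \<and> (\<forall>s\<in>V. \<forall>t\<in>V. s \<noteq> t \<longrightarrow> m s t = m t s \<and> 2 \<le> m s t)"

definition edges :: "'a set \<Rightarrow> ('a \<Rightarrow> 'a \<Rightarrow> enat) \<Rightarrow> ('a \<times> 'a) set" where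
  "edges V m = {(s, t). s \<in> V \<and> t \<in> V \<and> s \<noteq> t \<and> m s t < \<infinity>}"

text \<open>The positive word \<open>s t s \<dots>\<close> with the given number of letters.\<close>

fun alt_word :: "'a \<Rightarrow> 'a \<Rightarrow> nat \<Rightarrow> 'a word" where
  "alt_word s t 0 = []"
| "alt_word s t (Suc n) = (s, True) # alt_word t s n"

definition artin_rels :: "'a set \<Rightarrow> ('a \<Rightarrow> 'a \<Rightarrow> enat) \<Rightarrow> ('a word \<times> 'a word) set" where
  "artin_rels V m = {(alt_word s t n, alt_word t s n) | s t n. (s, t) \<in> edges V m \<and> m s t = enat n}"

definition artin_group :: "'a set \<Rightarrow> ('a \<Rightarrow> 'a \<Rightarrow> enat) \<Rightarrow> 'a word set monoid" where
  "artin_group V m = presented_group V (artin_rels V m)"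

definition artin_gen :: "'a set \<Rightarrow> ('a \<Rightarrow> 'a \<Rightarrow> enat) \<Rightarrow> 'a \<Rightarrow> 'a word set" where
  "artin_gen V m s = pres_gen V (artin_rels V m) s"

definition coxeter_group :: "'a set \<Rightarrow> ('a \<Rightarrow> 'a \<Rightarrow> enat) \<Rightarrow> 'a word set set monoid" where
  "coxeter_group V m = artin_group V m Mod
     normal_closure (artin_group V m)
       {artin_gen V m s \<otimes>\<^bsub>artin_group V m\<^esub> artin_gen V m s | s. s \<in> V}"

definition finite_type :: "'a set \<Rightarrow> ('a \<Rightarrow> 'a \<Rightarrow> enat) \<Rightarrow> bool" where
  "finite_type V m \<longleftrightarrow> finite (carrier (coxeter_group V m))"

text \<open>In \<open>finite_type {a, b, c} m\<close> the labels are restricted to the triangle, so this is the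
  Artin group on the full subgraph spanned by \<open>a\<close>, \<open>b\<close>, \<open>c\<close>.\<close>

definition locally_reducible :: "'a set \<Rightarrow> ('a \<Rightarrow> 'a \<Rightarrow> enat) \<Rightarrow> bool" where
  "locally_reducible V m \<longleftrightarrow>
     (\<forall>a b c. (a, b) \<in> edges V m \<and> (b, c) \<in> edges V m \<and> (a, c) \<in> edges V m
        \<and> finite_type {a, b, c} m \<longrightarrow>
        (m a b = 2 \<and> m b c = 2) \<or> (m a b = 2 \<and> m a c = 2) \<or> (m b c = 2 \<and> m a c = 2))"


section \<open>Parabolic subgroups and 2-completions\<close>

definition std_parabolic :: "'a set \<Rightarrow> ('a \<Rightarrow> 'a \<Rightarrow> enat) \<Rightarrow> 'a set \<Rightarrow> 'a word set set" where
  "std_parabolic V m T = generate (artin_group V m) (artin_gen V m ` T)"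

definition parabolic :: "'a set \<Rightarrow> ('a \<Rightarrow> 'a \<Rightarrow> enat) \<Rightarrow> 'a word set set \<Rightarrow> bool" where
  "parabolic V m P \<longleftrightarrow>
     (\<exists>g\<in>carrier (artin_group V m). \<exists>T\<subseteq>V. P = conj_subset (artin_group V m) g (std_parabolic V m T))"

definition hat_edges :: "'a set \<Rightarrow> ('a \<Rightarrow> 'a \<Rightarrow> enat) \<Rightarrow> ('a \<times> 'a) set" where
  "hat_edges V m = {(s, t) \<in> edges V m. m s t = 2}"

text \<open>Vertex sets of the connected components of the graph with the edges labelled 2; its edge
  relation is symmetric, so reachability is an equivalence relation on \<open>V\<close>.\<close>

definition hat_components :: "'a set \<Rightarrow> ('a \<Rightarrow> 'a \<Rightarrow> enat) \<Rightarrow> 'a set set" where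
  "hat_components V m = V // (hat_edges V m)\<^sup>*"

definition two_complete :: "'a set \<Rightarrow> ('a \<Rightarrow> 'a \<Rightarrow> enat) \<Rightarrow> 'a word set set \<Rightarrow> bool" where
  "two_complete V m Q \<longleftrightarrow>
     (\<exists>g\<in>carrier (artin_group V m). \<exists>C\<subseteq>hat_components V m.
        Q = conj_subset (artin_group V m) g (std_parabolic V m (\<Union>C)))"

definition two_completion ::
  "'a set \<Rightarrow> ('a \<Rightarrow> 'a \<Rightarrow> enat) \<Rightarrow> 'a word set set \<Rightarrow> 'a word set set \<Rightarrow> bool" where
  "two_completion V m P Q \<longleftrightarrow> two_complete V m Q \<and> P \<subseteq> Q"

end

theory Submission
  imports Defs Complex_Main
begin

text \<open>The 2-completion is a conjugate of a standard parabolic subgroup \<open>A\<^sub>T\<close>, where \<open>T\<close> is a union of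
  components of the graph of edges labelled 2 and \<open>T \<noteq> V\<close>. So there is a vertex \<open>u \<notin> T\<close>, and the
  label of \<open>u\<close> and \<open>t\<close> is at least 3, or infinite, for every \<open>t \<in> T\<close>. The heart of the matter is that
  then \<open>A\<^sub>T \<inter> u A\<^sub>T u\<^sup>-\<^sup>1\<close> is trivial (\<open>std_parabolic_meets_conjugate_trivially\<close>); conjugating, the 2-completion meets one of its conjugates
  trivially, and so does every subset of it.

  To see this, let the Artin group \<open>A\<close> act from the right on pairs \<open>(g, a)\<close>, where \<open>a \<in> A\<close> and \<open>g\<close>
  is an element of the Coxeter group (in its geometric representation) that sends the simple roots
  of \<open>T\<close> to nonnegative vectors. These \<open>g\<close> are the inverses of the minimal representatives of the
  cosets \<open>W\<^sub>T w\<close>. A generator \<open>s\<close> normally moves \<open>(g, a)\<close> to \<open>(s g, a)\<close>. When \<open>s g\<close> leaves the set of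
  permitted elements, \<open>g\<close> sends some simple root \<open>\<alpha>\<^sub>t\<close> with \<open>t \<in> T\<close> to \<open>\<alpha>\<^sub>s\<close>, and then \<open>s\<close> moves
  \<open>(g, a)\<close> to \<open>(g, a t)\<close>. This dichotomy rests on Tits' theorem that every root has coordinates of one
  sign (\<open>root_pos_or_neg\<close>). That the rule respects the Artin relations (\<open>braid_run\<close>) is
  a statement about dihedral groups: under two generators \<open>x\<close>, \<open>y\<close>, the element \<open>g\<close> either runs through a
  full dihedral orbit without meeting such an obstruction, or is blocked by both generators, whose
  blocking labels then satisfy the same Artin relation, or moves on a path of \<open>m\<close>
  elements (\<open>m\<close> the label of \<open>x\<close> and \<open>y\<close>), both ends of which are blocked with the same label \<open>t\<close>.

  Starting at \<open>(1, 1)\<close>, an element \<open>a \<in> A\<^sub>T\<close> leads to \<open>(1, a)\<close>, and \<open>u\<close> then leads to \<open>(u, a)\<close>. On the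
  other hand \<open>u\<close> leads to \<open>(u, 1)\<close>, and from there no element of \<open>A\<^sub>T\<close> ever changes the second
  component: \<open>u \<alpha>\<^sub>t = \<alpha>\<^sub>t + c \<alpha>\<^sub>u\<close> with \<open>c > 0\<close> because the label of \<open>u\<close> and \<open>t\<close> is not 2, reflections
  in \<open>T\<close> do not touch the \<open>u\<close>-coordinate, and so no \<open>\<alpha>\<^sub>t\<close> is ever sent to an \<open>\<alpha>\<^sub>s\<close> with \<open>s \<in> T\<close>.
  Hence \<open>a u = u b\<close> with \<open>a, b \<in> A\<^sub>T\<close> forces \<open>a = 1\<close>.\<close>

section \<open>The geometric representation\<close>

text \<open>Chebyshev polynomials of the second kind, shifted by one and evaluated at \<open>c / 2\<close>: for
  \<open>c = 2 cos x\<close> the value is \<open>sin (k x) / sin x\<close>. They are the coefficients of the roots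
  of a dihedral group with respect to its two simple roots.\<close>

fun cheb :: "real \<Rightarrow> nat \<Rightarrow> real" where
  "cheb c 0 = 0"
| "cheb c (Suc 0) = 1"
| "cheb c (Suc (Suc k)) = c * cheb c (Suc k) - cheb c k"

lemma cheb_two: "cheb 2 k = real k"
  by (induction "2::real" k rule: cheb.induct) (auto simp: algebra_simps)

lemma cheb_cos: "cheb (2 * cos x) k * sin x = sin (real k * x)"
proof (induction k rule: induct_nat_012)
  case (ge2 k)
  have e: "sin (real (Suc (Suc k)) * x) + sin (real k * x) = 2 * cos x * sin (real (Suc k) * x)"
  proof -
    have "real (Suc (Suc k)) * x = real (Suc k) * x + x" "real k * x = real (Suc k) * x - x"
      by (simp_all add: algebra_simps)
    then show ?thesis by (simp only: sin_add sin_diff) (simp add: algebra_simps)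
  qed
  have "cheb (2 * cos x) (Suc (Suc k)) * sin x
      = 2 * cos x * (cheb (2 * cos x) (Suc k) * sin x) - cheb (2 * cos x) k * sin x"
    by (simp add: algebra_simps)
  also have "\<dots> = sin (real (Suc (Suc k)) * x)" using e ge2 by simp
  finally show ?case .
qed auto

definition simple_root :: "'a \<Rightarrow> 'a \<Rightarrow> real" where
  "simple_root s = (\<lambda>x. of_bool (x = s))"

lemma simple_root_inject [simp]: "simple_root s = simple_root t \<longleftrightarrow> s = t"
  by (auto simp: simple_root_def fun_eq_iff)

definition lin :: "(('a \<Rightarrow> real) \<Rightarrow> 'a \<Rightarrow> real) \<Rightarrow> bool" where
  "lin w \<longleftrightarrow> (\<forall>a b f h. w (\<lambda>x. a * f x + b * h x) = (\<lambda>x. a * w f x + b * w h x))"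

lemma linD: "lin w \<Longrightarrow> w (\<lambda>x. a * f x + b * h x) = (\<lambda>x. a * w f x + b * w h x)"
  unfolding lin_def by blast

lemma lin_scale: "lin w \<Longrightarrow> w (\<lambda>x. a * f x) = (\<lambda>x. a * w f x)"
  using linD[of w a f 0 f] by simp

lemma lin_uminus: "lin w \<Longrightarrow> w (\<lambda>x. - f x) = (\<lambda>x. - w f x)"
  using lin_scale[of w "-1" f] by simp

lemma lin_comp: "lin v \<Longrightarrow> lin w \<Longrightarrow> lin (v \<circ> w)"
  unfolding lin_def by simp

locale artin_graph =
  fixes V :: "'a set" and m :: "'a \<Rightarrow> 'a \<Rightarrow> enat"
  assumes labels: "artin_labels V m"
begin

lemma finite_V: "finite V"
  using labels unfolding artin_labels_def by blast

lemma m_sym: "s \<in> V \<Longrightarrow> t \<in> V \<Longrightarrow> m s t = m t s"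
  using labels unfolding artin_labels_def by metis

lemma m_ge2: "s \<in> V \<Longrightarrow> t \<in> V \<Longrightarrow> s \<noteq> t \<Longrightarrow> 2 \<le> m s t"
  using labels unfolding artin_labels_def by metis

text \<open>For distinct vertices this is \<open>- B(\<alpha>\<^sub>s, \<alpha>\<^sub>t)\<close>, where \<open>B\<close> is the standard bilinear form of the
  Coxeter group, normalised by \<open>B(\<alpha>\<^sub>s, \<alpha>\<^sub>s) = 2\<close>. It is \<open>0\<close> if the label is 2 and positive for
  larger labels.\<close>

definition coef :: "'a \<Rightarrow> 'a \<Rightarrow> real" where
  "coef s t = (case m s t of enat n \<Rightarrow> 2 * cos (pi / real n) | \<infinity> \<Rightarrow> 2)"

definition gram :: "'a \<Rightarrow> 'a \<Rightarrow> real" where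
  "gram s t = (if s = t then 2 else - coef s t)"

lemma gram_sym: "s \<in> V \<Longrightarrow> t \<in> V \<Longrightarrow> gram s t = gram t s"
  by (simp add: gram_def coef_def m_sym)

lemma coef_sym: "s \<in> V \<Longrightarrow> t \<in> V \<Longrightarrow> coef s t = coef t s"
  by (simp add: coef_def m_sym)

text \<open>The value \<open>B(\<alpha>\<^sub>s, f)\<close>. Vectors are real functions, of which only the values on \<open>V\<close> enter the
  bilinear form.\<close>

definition pairing :: "'a \<Rightarrow> ('a \<Rightarrow> real) \<Rightarrow> real" where
  "pairing s f = (\<Sum>t\<in>V. gram s t * f t)"

definition reflect :: "'a \<Rightarrow> ('a \<Rightarrow> real) \<Rightarrow> 'a \<Rightarrow> real" where
  "reflect s f = (\<lambda>x. f x - pairing s f * simple_root s x)"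

lemma pairing_lin: "pairing s (\<lambda>x. a * f x + b * h x) = a * pairing s f + b * pairing s h"
  unfolding pairing_def by (simp add: algebra_simps sum.distrib sum_distrib_left)

lemma pairing_root: "t \<in> V \<Longrightarrow> pairing s (simple_root t) = gram s t"
  unfolding pairing_def simple_root_def using finite_V by (simp add: if_distrib of_bool_def cong: if_cong)

lemma lin_reflect: "lin (reflect s)"
  unfolding lin_def reflect_def by (simp add: pairing_lin algebra_simps)

lemma reflect_root_self: "s \<in> V \<Longrightarrow> reflect s (simple_root s) = (\<lambda>x. - simple_root s x)"
  by (simp add: reflect_def pairing_root gram_def fun_eq_iff)

lemma reflect_root_other:
  "t \<in> V \<Longrightarrow> s \<noteq> t \<Longrightarrow> reflect s (simple_root t) = (\<lambda>x. simple_root t x + coef s t * simple_root s x)"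
  by (simp add: reflect_def pairing_root gram_def fun_eq_iff)

lemma reflect_reflect:
  assumes "s \<in> V" shows "reflect s (reflect s f) = f"
proof -
  have "reflect s f = (\<lambda>x. 1 * f x + (- pairing s f) * simple_root s x)" by (simp add: reflect_def)
  then have "pairing s (reflect s f) = - pairing s f"
    using assms by (simp only: pairing_lin pairing_root) (simp add: gram_def)
  then show ?thesis unfolding reflect_def[of s "reflect s f"] by (simp add: reflect_def)
qed

lemma reflect_comp [simp]: "s \<in> V \<Longrightarrow> reflect s \<circ> (reflect s \<circ> g) = g"
  by (simp add: fun_eq_iff reflect_reflect)

lemma reflect_other: "x \<noteq> s \<Longrightarrow> reflect s f x = f x"
  by (simp add: reflect_def simple_root_def)

definition form :: "('a \<Rightarrow> real) \<Rightarrow> ('a \<Rightarrow> real) \<Rightarrow> real" where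
  "form f h = (\<Sum>s\<in>V. f s * pairing s h)"

lemma form_sym: "form f h = form h f"
proof -
  have "form f h = (\<Sum>s\<in>V. \<Sum>t\<in>V. f s * (gram s t * h t))"
    unfolding form_def pairing_def by (simp add: sum_distrib_left)
  also have "\<dots> = (\<Sum>t\<in>V. \<Sum>s\<in>V. f s * (gram s t * h t))" by (rule sum.swap)
  also have "\<dots> = (\<Sum>t\<in>V. \<Sum>s\<in>V. h t * (gram t s * f s))"
    by (intro sum.cong) (auto simp: gram_sym)
  also have "\<dots> = form h f" unfolding form_def pairing_def by (simp add: sum_distrib_left)
  finally show ?thesis .
qed

lemma form_lin: "form (\<lambda>x. a * f x + b * f' x) h = a * form f h + b * form f' h"
  unfolding form_def by (simp add: algebra_simps sum.distrib sum_distrib_left)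

lemma form_root: "s \<in> V \<Longrightarrow> form (simple_root s) h = pairing s h"
  using finite_V sum.delta[of V s "\<lambda>t. pairing t h"]
  by (auto simp: form_def simple_root_def of_bool_def if_distrib[of "\<lambda>z. z * _"] cong: if_cong)

lemma form_reflect:
  assumes s: "s \<in> V" shows "form (reflect s f) (reflect s h) = form f h"
proof -
  have r: "reflect s f = (\<lambda>x. 1 * f x + (- pairing s f) * simple_root s x)" for f by (simp add: reflect_def)
  have l: "form (reflect s f) h = form f h - pairing s f * pairing s h" for f h
    unfolding r form_lin using s by (simp add: form_root)
  have p: "pairing s (reflect s f) = - pairing s f" for f
    unfolding r pairing_lin using s by (simp add: pairing_root gram_def)
  have "form (reflect s f) (reflect s h) = form f (reflect s h) + pairing s f * pairing s h"
    by (simp add: l p)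
  also have "form f (reflect s h) = form f h - pairing s f * pairing s h"
    using l[of h f] form_sym by simp
  finally show ?thesis by simp
qed


section \<open>Rank two\<close>

text \<open>The alternating product of \<open>k\<close> reflections in which \<open>x\<close> is applied first. Its recursion is
  that of \<open>alt_word\<close>, so that reading \<open>alt_word x y k\<close> letter by letter moves \<open>g\<close> to
  \<open>alt_act x y k \<circ> g\<close> as long as nothing blocks the way.\<close>

fun alt_act :: "'a \<Rightarrow> 'a \<Rightarrow> nat \<Rightarrow> ('a \<Rightarrow> real) \<Rightarrow> 'a \<Rightarrow> real" where
  "alt_act x y 0 f = f"
| "alt_act x y (Suc k) f = alt_act y x k (reflect x f)"

lemma alt_act_last:
  "alt_act x y (Suc k) f = reflect (if even k then x else y) (alt_act x y k f)"
proof (induction k arbitrary: x y f)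
  case (Suc k)
  have "alt_act x y (Suc (Suc k)) f = alt_act y x (Suc k) (reflect x f)" by simp
  also have "\<dots> = reflect (if even k then y else x) (alt_act y x k (reflect x f))" by (rule Suc.IH)
  finally show ?case by simp
qed simp

lemma lin_alt_act: "lin (alt_act x y k)"
proof (induction k arbitrary: x y)
  case 0 then show ?case by (simp add: lin_def)
next
  case (Suc k)
  have "alt_act x y (Suc k) = alt_act y x k \<circ> reflect x" by (simp add: fun_eq_iff)
  then show ?case by (simp only: lin_comp[OF Suc.IH lin_reflect])
qed

text \<open>The orbit of a simple root under the dihedral group. The first coefficient belongs to the
  generator applied last, the second one to the generator that comes next.\<close>

lemma alt_act_root:
  assumes "x \<in> V" "y \<in> V" "x \<noteq> y"
  shows "alt_act y x k (simple_root x) =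
    (\<lambda>i. cheb (coef x y) (Suc k) * simple_root (if even k then x else y) i
       + cheb (coef x y) k * simple_root (if even k then y else x) i)"
proof (induction k)
  case (Suc k)
  let ?l = "if even k then x else y" and ?z = "if even k then y else x"
  have lz: "?l \<in> V" "?z \<in> V" "?z \<noteq> ?l" and c: "coef ?z ?l = coef x y"
    using assms by (auto simp: coef_sym)
  have "alt_act y x (Suc k) (simple_root x) = reflect ?z (\<lambda>i. cheb (coef x y) (Suc k) * simple_root ?l i
       + cheb (coef x y) k * simple_root ?z i)"
    unfolding alt_act_last Suc.IH ..
  also have "\<dots> = (\<lambda>i. cheb (coef x y) (Suc k) * (simple_root ?l i + coef x y * simple_root ?z i)
       - cheb (coef x y) k * simple_root ?z i)"
    unfolding linD[OF lin_reflect] reflect_root_self[OF lz(2)] reflect_root_other[OF lz(1,3)] c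
    by simp
  finally show ?case by (auto simp: fun_eq_iff algebra_simps)
qed simp

lemma coef_edge:
  assumes "m x y = enat n" "x \<in> V" "y \<in> V" "x \<noteq> y"
  shows "2 \<le> n" and "coef x y = 2 * cos (pi / n)" and "0 < sin (pi / n)"
proof -
  show n: "2 \<le> n"
    using m_ge2[OF assms(2-)] assms(1) by (metis enat_ord_simps(1) numeral_eq_enat)
  show "coef x y = 2 * cos (pi / n)" using assms(1) by (simp add: coef_def)
  show "0 < sin (pi / n)" using n by (intro sin_gt_zero) (auto simp: field_simps)
qed

lemma cheb_edge:
  assumes "m x y = enat n" "x \<in> V" "y \<in> V" "x \<noteq> y"
  shows cheb_edge_pos: "0 < k \<Longrightarrow> k < n \<Longrightarrow> 0 < cheb (coef x y) k"
    and cheb_edge_last: "cheb (coef x y) (n - 1) = 1"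
    and cheb_edge_zero: "cheb (coef x y) n = 0"
    and cheb_edge_Suc: "cheb (coef x y) (Suc n) = - 1"
proof -
  note e = coef_edge[OF assms]
  have eq: "cheb (coef x y) k = sin (real k * (pi / n)) / sin (pi / n)" for k
    using cheb_cos[of "pi / n" k] e(2,3) by (simp add: field_simps)
  show "0 < cheb (coef x y) k" if "0 < k" "k < n"
  proof -
    have "real k * pi < real n * pi" using that by simp
    then have "real k * (pi / n) < pi" using that by (simp add: field_simps)
    moreover have "0 < real k * (pi / n)" using that by simp
    ultimately show ?thesis unfolding eq using e(3) sin_gt_zero divide_pos_pos by blast
  qed
  have n: "real n * (pi / n) = pi" using e(1) by simp
  have "real (n - 1) * (pi / n) = pi - pi / n"
    using e(1) by (simp add: of_nat_diff field_simps)
  then show "cheb (coef x y) (n - 1) = 1" unfolding eq using e(3) by simp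
  show "cheb (coef x y) n = 0" unfolding eq n by simp
  have "real (Suc n) * (pi / n) = pi + pi / n" using e(1) by (simp add: field_simps)
  then show "cheb (coef x y) (Suc n) = - 1" unfolding eq using e(3) by simp
qed

lemma cheb_infinite: "m x y = \<infinity> \<Longrightarrow> cheb (coef x y) k = real k"
  by (simp add: coef_def cheb_two)

lemma alt_act_fixed:
  "pairing x f = 0 \<Longrightarrow> pairing y f = 0 \<Longrightarrow> alt_act x y k f = f"
  by (induction k arbitrary: x y) (auto simp: reflect_def)

text \<open>The longest element of the dihedral group sends each simple root to the negative of a simple
  root, and which one depends only on the parity of \<open>n\<close>, not on the generator applied first.\<close>

lemma alt_act_longest_root:
  assumes "m x y = enat n" "x \<in> V" "y \<in> V" "x \<noteq> y"
  shows "alt_act y x n (simple_root x) = (\<lambda>i. - simple_root (if even n then x else y) i)"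
    and "alt_act x y n (simple_root x) = (\<lambda>i. - simple_root (if even n then x else y) i)"
proof -
  show "alt_act y x n (simple_root x) = (\<lambda>i. - simple_root (if even n then x else y) i)"
    unfolding alt_act_root[OF assms(2-)] by (simp add: cheb_edge[OF assms])
  obtain k where k: "n = Suc k" using coef_edge(1)[OF assms] by (cases n) auto
  have "alt_act x y n (simple_root x) = alt_act y x k (\<lambda>i. - simple_root x i)"
    unfolding k using assms by (simp add: reflect_root_self)
  also have "\<dots> = (\<lambda>i. - alt_act y x k (simple_root x) i)" by (rule lin_uminus[OF lin_alt_act])
  also have "\<dots> = (\<lambda>i. - simple_root (if even n then x else y) i)"
    unfolding alt_act_root[OF assms(2-)]
    using cheb_edge_last[OF assms] cheb_edge_zero[OF assms] by (simp add: k)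
  finally show "alt_act x y n (simple_root x) = (\<lambda>i. - simple_root (if even n then x else y) i)" .
qed

text \<open>The bilinear form is nondegenerate on the plane of \<open>\<alpha>\<^sub>x\<close> and \<open>\<alpha>\<^sub>y\<close>, its determinant being
  \<open>4 - c\<^sup>2 = 4 sin\<^sup>2 (\<pi> / n)\<close>. So every vector is the sum of one in this plane, where
  \<open>alt_act_longest_root\<close> applies, and one orthogonal to it, which is fixed.\<close>

lemma braid_alt_act:
  assumes "m x y = enat n" "x \<in> V" "y \<in> V" "x \<noteq> y"
  shows "alt_act x y n f = alt_act y x n f"
proof -
  have m': "m y x = enat n" using assms by (simp add: m_sym)
  define c where "c = coef x y"
  define p where "p = pairing x f"
  define q where "q = pairing y f"
  define d where "d = 4 - c\<^sup>2"
  \<comment> \<open>Coordinates of the projection to the plane, by Cramer's rule.\<close>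
  define a where "a = (2 * p + c * q) / d"
  define b where "b = (2 * q + c * p) / d"
  define f0 where "f0 = (\<lambda>i. 1 * f i + (-1) * (a * simple_root x i + b * simple_root y i))"
  have "d = 4 * (sin (pi / n))\<^sup>2"
    unfolding d_def c_def coef_edge(2)[OF assms] by (simp add: sin_squared_eq power_mult_distrib)
  then have d: "d \<noteq> 0" using coef_edge(3)[OF assms] by simp
  have pr: "pairing z f0 = pairing z f - (a * pairing z (simple_root x) + b * pairing z (simple_root y))" for z
    unfolding f0_def pairing_lin by simp
  have ab: "2 * a - c * b = p" "2 * b - c * a = q"
  proof -
    have "d * (2 * a - c * b) = d * p" "d * (2 * b - c * a) = d * q"
      unfolding a_def b_def using d by (simp_all add: field_simps) (simp_all add: d_def algebra_simps power2_eq_square)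
    then show "2 * a - c * b = p" "2 * b - c * a = q" using d by simp_all
  qed
  have x0: "pairing x f0 = 0" and y0: "pairing y f0 = 0"
    unfolding pr using assms ab
    by (simp_all add: pairing_root gram_def c_def p_def q_def coef_sym[of y x] mult.commute)
  have f: "f = (\<lambda>i. 1 * f0 i + 1 * (a * simple_root x i + b * simple_root y i))" by (simp add: f0_def)
  note long = alt_act_longest_root[OF assms] alt_act_longest_root[OF m' assms(3,2) assms(4)[symmetric]]
  show ?thesis
    by (subst (1 2) f)
       (simp only: linD[OF lin_alt_act] alt_act_fixed[OF x0 y0] alt_act_fixed[OF y0 x0] long)
qed


section \<open>Positive and negative roots\<close>

definition act :: "'a list \<Rightarrow> ('a \<Rightarrow> real) \<Rightarrow> 'a \<Rightarrow> real" where
  "act xs = foldr reflect xs"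

lemma act_simps [simp]: "act [] = id" "act (x # xs) = reflect x \<circ> act xs"
  "act (xs @ ys) = act xs \<circ> act ys"
  by (simp_all add: act_def fun_eq_iff)

definition weyl :: "(('a \<Rightarrow> real) \<Rightarrow> 'a \<Rightarrow> real) set" where
  "weyl = act ` lists V"

definition len :: "(('a \<Rightarrow> real) \<Rightarrow> 'a \<Rightarrow> real) \<Rightarrow> nat" where
  "len w = (LEAST n. \<exists>xs\<in>lists V. act xs = w \<and> length xs = n)"

lemma weyl_id: "id \<in> weyl"
  unfolding weyl_def by (rule image_eqI[of _ _ "[]"]) auto

lemma weyl_comp: "v \<in> weyl \<Longrightarrow> w \<in> weyl \<Longrightarrow> v \<circ> w \<in> weyl"
  unfolding weyl_def by (auto simp flip: act_simps(3) intro!: imageI)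

lemma weyl_reflect: "s \<in> V \<Longrightarrow> reflect s \<in> weyl"
  unfolding weyl_def by (rule image_eqI[of _ _ "[s]"]) auto

lemma len_le: "xs \<in> lists V \<Longrightarrow> len (act xs) \<le> length xs"
  unfolding len_def by (rule Least_le) auto

lemma reduced_word:
  assumes "w \<in> weyl"
  obtains xs where "xs \<in> lists V" "act xs = w" "length xs = len w"
proof -
  have "\<exists>n. \<exists>xs\<in>lists V. act xs = w \<and> length xs = n" using assms unfolding weyl_def by auto
  from LeastI_ex[OF this] show ?thesis using that unfolding len_def by blast
qed

lemma len_comp: "v \<in> weyl \<Longrightarrow> w \<in> weyl \<Longrightarrow> len (v \<circ> w) \<le> len v + len w"
proof -
  assume v: "v \<in> weyl" and w: "w \<in> weyl"
  obtain xs ys where "xs \<in> lists V" "act xs = v" "length xs = len v"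
    "ys \<in> lists V" "act ys = w" "length ys = len w"
    using reduced_word[OF v] reduced_word[OF w] by metis
  then show ?thesis using len_le[of "xs @ ys"] by simp
qed

lemma weyl_lin: "w \<in> weyl \<Longrightarrow> lin w"
proof -
  have "lin (act xs)" for xs
  proof (induction xs)
    case Nil then show ?case by (simp add: lin_def)
  next
    case (Cons x xs) then show ?case by (simp only: act_simps lin_comp lin_reflect)
  qed
  then show "w \<in> weyl \<Longrightarrow> lin w" unfolding weyl_def by auto
qed

lemma weyl_form: "w \<in> weyl \<Longrightarrow> form (w f) (w h) = form f h"
proof -
  have "xs \<in> lists V \<Longrightarrow> form (act xs f) (act xs h) = form f h" for xs
    by (induction xs) (auto simp: form_reflect)
  then show "w \<in> weyl \<Longrightarrow> form (w f) (w h) = form f h" unfolding weyl_def by auto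
qed

lemma weyl_inverse:
  assumes "w \<in> weyl"
  obtains v where "v \<in> weyl" "v \<circ> w = id" "w \<circ> v = id"
proof -
  have "xs \<in> lists V \<Longrightarrow> \<exists>v\<in>weyl. v \<circ> act xs = id \<and> act xs \<circ> v = id" for xs
  proof (induction xs)
    case Nil show ?case by (rule bexI[OF _ weyl_id]) simp
  next
    case (Cons x xs)
    then have "\<exists>v\<in>weyl. v \<circ> act xs = id \<and> act xs \<circ> v = id"
      by (metis Cons_in_lists_iff)
    then obtain v where v: "v \<in> weyl" "v \<circ> act xs = id" "act xs \<circ> v = id" by blast
    have "v \<circ> reflect x \<in> weyl" using v Cons.prems by (simp add: weyl_comp weyl_reflect)
    moreover have "(v \<circ> reflect x) \<circ> act (x # xs) = id"
      using v(2) Cons.prems by (simp add: comp_assoc)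
    moreover have "act (x # xs) \<circ> (v \<circ> reflect x) = id"
    proof -
      have "act xs \<circ> (v \<circ> reflect x) = reflect x" by (simp add: v(3) flip: comp_assoc)
      then show ?thesis using reflect_comp[of x id] Cons.prems by (simp add: comp_assoc)
    qed
    ultimately show ?case by blast
  qed
  then show ?thesis using assms that unfolding weyl_def by (metis imageE)
qed

lemma alt_act_word:
  "x \<in> V \<Longrightarrow> y \<in> V \<Longrightarrow> \<exists>xs\<in>lists V. act xs = alt_act x y k \<and> length xs = k"
proof (induction k arbitrary: x y)
  case 0 then show ?case by (intro bexI[of _ "[]"]) (auto simp: fun_eq_iff)
next
  case (Suc k)
  then obtain xs where "xs \<in> lists V" "act xs = alt_act y x k" "length xs = k" by blast
  then show ?case using Suc.prems by (intro bexI[of _ "xs @ [x]"]) (auto simp: fun_eq_iff)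
qed

lemma alt_act_weyl: "x \<in> V \<Longrightarrow> y \<in> V \<Longrightarrow> alt_act x y k \<in> weyl"
  and len_alt_act: "x \<in> V \<Longrightarrow> y \<in> V \<Longrightarrow> len (alt_act x y k) \<le> k"
  using alt_act_word[of x y k] len_le unfolding weyl_def by (metis image_eqI)+

lemma alt_act_last_comp:
  "alt_act x y (Suc k) = reflect (if even k then x else y) \<circ> alt_act x y k"
  by (simp only: fun_eq_iff alt_act_last o_apply) simp

lemma alt_act_add: "\<exists>u v. {u, v} \<subseteq> {x, y} \<and> alt_act x y (j + k) = alt_act u v j \<circ> alt_act x y k"
proof (induction k arbitrary: x y)
  case 0 show ?case by (rule exI[of _ x], rule exI[of _ y]) (simp add: fun_eq_iff)
next
  case (Suc k)
  from Suc[of y x] obtain u v where uv: "{u, v} \<subseteq> {y, x}"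
    "alt_act y x (j + k) = alt_act u v j \<circ> alt_act y x k" by metis
  have "alt_act x y (j + Suc k) f = (alt_act u v j \<circ> alt_act x y (Suc k)) f" for f
    using fun_cong[OF uv(2), of "reflect x f"] by simp
  then have "alt_act x y (j + Suc k) = alt_act u v j \<circ> alt_act x y (Suc k)" by (rule ext)
  then show ?case using uv(1) by (metis insert_commute)
qed

text \<open>Tits' argument, by induction on the length of \<open>w\<close>. If \<open>w\<close> has a reduced word ending in \<open>s'\<close>,
  split off from the right end as long an alternating product of \<open>s'\<close> and \<open>s\<close> as the length permits,
  \<open>w = v \<circ> alt_act s' s k\<close>. Neither \<open>s\<close> nor \<open>s'\<close> shortens \<open>v\<close> from the right: one of them by the
  maximality of \<open>k\<close>, the other one because \<open>w\<close> would become too short. So \<open>v\<close> sends both simple roots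
  to nonnegative vectors by induction. It remains to see that \<open>alt_act s' s k\<close> sends \<open>\<alpha>\<^sub>s\<close> to a
  nonnegative combination of the two; this holds for \<open>k < n\<close>, where \<open>n\<close> is the label of \<open>s\<close> and \<open>s'\<close>,
  and a finite \<open>n \<le> k\<close> is impossible because the braid relation would let \<open>w\<close> end in \<open>s\<close>.\<close>

lemma ascent_positive:
  assumes "w \<in> weyl" "s \<in> V" "len w \<le> len (w \<circ> reflect s)"
  shows "0 \<le> w (simple_root s) i"
  using assms
proof (induction "len w" arbitrary: w s i rule: less_induct)
  case less
  note w = less.prems(1) and s = less.prems(2)
  obtain xs where xs: "xs \<in> lists V" "act xs = w" "length xs = len w" using reduced_word[OF w] .
  show ?case
  proof (cases xs rule: rev_cases)
    case Nil
    then show ?thesis using xs by (auto simp: simple_root_def)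
  next
    case (snoc ys s')
    have s': "s' \<in> V" and ys: "ys \<in> lists V" using xs(1) snoc by auto
    have wys: "w = act ys \<circ> reflect s'" and lys: "len w = Suc (length ys)" using xs snoc by auto
    have neq: "s' \<noteq> s"
    proof
      assume "s' = s"
      then have "w \<circ> reflect s = act ys" unfolding wys using s by (auto simp: fun_eq_iff reflect_reflect)
      then show False using len_le[OF ys] lys less.prems(3) by simp
    qed
    define Q where "Q k \<longleftrightarrow> (\<exists>v\<in>weyl. w = v \<circ> alt_act s' s k \<and> len v + k \<le> len w)" for k
    \<comment> \<open>The maximal \<open>k\<close>; the final letter \<open>s'\<close> of the reduced word gives the case \<open>k = 1\<close>.\<close>
    have Q1: "Q (Suc 0)"
      unfolding Q_def using wys lys len_le[OF ys] ys
      by (intro bexI[of _ "act ys"]) (auto simp: weyl_def fun_eq_iff)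
    have Qb: "Q k \<Longrightarrow> k \<le> len w" for k unfolding Q_def by auto
    define k where "k = (GREATEST k. Q k)"
    have Qk: "Q k" and k1: "1 \<le> k" and nQ: "\<not> Q (Suc k)"
      using GreatestI_nat[of Q, OF Q1 Qb] Greatest_le_nat[of Q "Suc 0", OF Q1 Qb]
        Greatest_le_nat[of Q "Suc k", OF _ Qb]
      by (auto simp: k_def)
    then obtain v where v: "v \<in> weyl" "w = v \<circ> alt_act s' s k" "len v + k \<le> len w"
      unfolding Q_def by blast
    let ?l = "if even k then s else s'" and ?z = "if even k then s' else s"
    have lz: "?l \<in> V" "?z \<in> V" using s s' by auto
    have "len v \<le> len (v \<circ> reflect ?l)"
    proof (rule ccontr)
      assume less: "\<not> len v \<le> len (v \<circ> reflect ?l)"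
      obtain j where j: "k = Suc j" using k1 by (cases k) auto
      have alt: "alt_act s' s k = reflect ?l \<circ> alt_act s' s j" unfolding j alt_act_last_comp by simp
      have "w = (v \<circ> reflect ?l) \<circ> alt_act s' s j" unfolding v(2) alt by (rule o_assoc)
      then have "len w \<le> len (v \<circ> reflect ?l) + j"
        using len_comp[of "v \<circ> reflect ?l" "alt_act s' s j"] len_alt_act[OF s' s, of j]
          alt_act_weyl[OF s' s] weyl_comp[OF v(1) weyl_reflect[OF lz(1)]] by simp
      then show False using less v(3) j by simp
    qed
    moreover have "len v \<le> len (v \<circ> reflect ?z)"
    proof (rule ccontr)
      assume less: "\<not> len v \<le> len (v \<circ> reflect ?z)"
      have "w = (v \<circ> reflect ?z) \<circ> alt_act s' s (Suc k)"
        unfolding alt_act_last_comp using v(2) lz by (simp add: fun_eq_iff reflect_reflect)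
      then have "Q (Suc k)"
        unfolding Q_def using less v(3) weyl_comp[OF v(1) weyl_reflect[OF lz(2)]]
        by (intro bexI[of _ "v \<circ> reflect ?z"]) auto
      then show False using nQ by simp
    qed
    moreover have "len v < len w" using v(3) k1 by simp
    ultimately have pos: "0 \<le> v (simple_root ?l) i" "0 \<le> v (simple_root ?z) i"
      using less.hyps v(1) lz by blast+
    have "0 \<le> cheb (coef s s') k \<and> 0 \<le> cheb (coef s s') (Suc k)"
    proof (cases "m s s'")
      case (enat n)
      note edge = enat s s' neq[symmetric]
      have "k < n"
      proof (rule ccontr)
        assume "\<not> k < n"
        then have j: "k = (k - n) + n" by simp
        define j where "j = k - n"
        have j: "k = j + n" using j by (simp add: j_def)
        obtain n' where n': "n = Suc n'" using coef_edge(1)[OF edge] by (cases n) auto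
        obtain a b where ab: "{a, b} \<subseteq> {s', s}"
          "alt_act s' s (j + n) = alt_act a b j \<circ> alt_act s' s n"
          using alt_act_add[of s' s j n] by metis
        have ab_V: "a \<in> V" "b \<in> V" using ab(1) s s' by auto
        \<comment> \<open>The braid relation puts \<open>s\<close> at the right end, where it cancels.\<close>
        have braid: "alt_act s' s n f = alt_act s' s n' (reflect s f)" for f
          using braid_alt_act[OF edge, of f] n' by simp
        have ws: "w \<circ> reflect s = v \<circ> (alt_act a b j \<circ> alt_act s' s n')"
          unfolding v(2) j ab(2) by (rule ext) (simp add: braid reflect_reflect[OF s])
        have "len (w \<circ> reflect s) \<le> len v + (j + n')"
          unfolding ws using len_comp[OF v(1) weyl_comp[OF alt_act_weyl[OF ab_V] alt_act_weyl[OF s' s]], of j n']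
            len_comp[OF alt_act_weyl[OF ab_V] alt_act_weyl[OF s' s], of j n']
            len_alt_act[OF ab_V, of j] len_alt_act[OF s' s, of n']
          by linarith
        then show False using less.prems(3) v(3) j n' by simp
      qed
      then have "0 < cheb (coef s s') k" "0 < cheb (coef s s') (Suc k) \<or> Suc k = n"
        using cheb_edge_pos[OF edge, of k] cheb_edge_pos[OF edge, of "Suc k"] k1 by auto
      then show ?thesis using cheb_edge_zero[OF edge] by auto
    qed (simp_all add: cheb_infinite)
    moreover have "w (simple_root s) i =
        cheb (coef s s') (Suc k) * v (simple_root ?l) i + cheb (coef s s') k * v (simple_root ?z) i"
      unfolding v(2) o_apply alt_act_root[OF s s' neq[symmetric]] linD[OF weyl_lin[OF v(1)]] ..
    ultimately show ?thesis using pos by simp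
  qed
qed

text \<open>If \<open>s\<close> shortens \<open>w\<close>, then it does not shorten \<open>w \<circ> reflect s\<close>, and \<open>reflect s\<close> negates \<open>\<alpha>\<^sub>s\<close>.\<close>

lemma root_pos_or_neg:
  assumes w: "w \<in> weyl" and s: "s \<in> V"
  shows "(\<forall>i. 0 \<le> w (simple_root s) i) \<or> (\<forall>i. w (simple_root s) i \<le> 0)"
proof (cases "len w \<le> len (w \<circ> reflect s)")
  case True
  then show ?thesis using ascent_positive[OF w s] by blast
next
  case False
  have ws: "w \<circ> reflect s \<in> weyl" using w s by (simp add: weyl_comp weyl_reflect)
  have "(w \<circ> reflect s) \<circ> reflect s = w" using s by (simp add: fun_eq_iff reflect_reflect)
  then have "0 \<le> (w \<circ> reflect s) (simple_root s) i" for i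
    using ascent_positive[OF ws s, of i] False by simp
  moreover have "(w \<circ> reflect s) (simple_root s) = (\<lambda>i. - w (simple_root s) i)"
    unfolding o_apply reflect_root_self[OF s] by (rule lin_uminus[OF weyl_lin[OF w]])
  ultimately have "0 \<le> - w (simple_root s) i" for i by metis
  then show ?thesis by simp
qed

text \<open>All roots have the same length for the invariant form.\<close>

lemma weyl_unit_multiple:
  assumes "w \<in> weyl" "t \<in> V" "s \<in> V" "w (simple_root t) = (\<lambda>i. c * simple_root s i)" "0 \<le> c"
  shows "c = 1"
proof -
  have sc: "form (\<lambda>i. c * simple_root s i) h = c * form (simple_root s) h" for h
    using form_lin[of c "simple_root s" 0 "simple_root s" h] by simp
  have "2 = form (w (simple_root t)) (w (simple_root t))"
    using assms(1,2) by (simp add: weyl_form form_root pairing_root gram_def)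
  also have "\<dots> = c * form (simple_root s) (\<lambda>i. c * simple_root s i)"
    unfolding assms(4) by (rule sc)
  also have "form (simple_root s) (\<lambda>i. c * simple_root s i) = c * form (simple_root s) (simple_root s)"
    using form_sym sc by metis
  also have "c * (c * form (simple_root s) (simple_root s)) = 2 * c\<^sup>2" using assms(3) by (simp add: form_root pairing_root gram_def power2_eq_square)
  finally show ?thesis using assms(5) by (simp add: power2_eq_1_iff)
qed

lemma weyl_inject: assumes "w \<in> weyl" shows "w f = w h \<longleftrightarrow> f = h"
proof -
  obtain v where "v \<circ> w = id" using weyl_inverse[OF assms] .
  then have "v (w f) = f" for f by (simp add: fun_eq_iff)
  then show ?thesis by metis
qed

text \<open>The map from labels \<open>n\<close> to \<open>cos (\<pi> / n)\<close> is injective, with \<open>\<infinity>\<close> corresponding to the angle \<open>0\<close>.\<close>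

lemma coef_inject:
  assumes "coef s t = coef x y" "s \<in> V" "t \<in> V" "s \<noteq> t" "x \<in> V" "y \<in> V" "x \<noteq> y"
  shows "m s t = m x y"
proof -
  have inj: "z = z'" if "cos z = cos z'" "0 \<le> z" "z \<le> pi" "0 \<le> z'" "z' \<le> pi" for z z'
    using that cos_inj_pi by blast
  have range: "0 < pi / real n" "pi / real n \<le> pi" if "2 \<le> n" for n
    using that by (auto simp: field_simps)
  have one: "cos (pi / real n) \<noteq> 1" if "2 \<le> n" for n
    using inj[of "pi / real n" 0] range[OF that] by auto
  have fin: "n = n'" if "cos (pi / real n) = cos (pi / real n')" "2 \<le> n" "2 \<le> n'" for n n'
    using inj[OF that(1)] range[OF that(2)] range[OF that(3)] by simp
  show ?thesis
  proof (cases "m s t")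
    case (enat n)
    note n = coef_edge(1,2)[OF enat assms(2-4)]
    show ?thesis
    proof (cases "m x y")
      case (enat n')
      note n' = coef_edge(1,2)[OF enat assms(5-7)]
      show ?thesis using assms(1) fin[of n n'] n n' \<open>m s t = enat n\<close> enat by simp
    next
      case infinity
      then show ?thesis using assms(1) one[of n] n by (simp add: coef_def[of x y])
    qed
  next
    case infinity
    show ?thesis
    proof (cases "m x y")
      case (enat n')
      note n' = coef_edge(1,2)[OF enat assms(5-7)]
      show ?thesis using assms(1) one[of n'] n' infinity by (simp add: coef_def[of s t])
    qed (simp add: infinity)
  qed
qed

lemma alt_act_undo:
  assumes "x \<in> V" "y \<in> V"
  shows "alt_act (if even k then y else x) (if even k then x else y) k (alt_act x y k f) = f"
proof (induction k)
  case (Suc k)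
  have "alt_act (if even (Suc k) then y else x) (if even (Suc k) then x else y) (Suc k) (alt_act x y (Suc k) f)
     = alt_act (if even k then y else x) (if even k then x else y) k (alt_act x y k f)"
    unfolding alt_act_last[of x y k f] using assms by (simp add: reflect_reflect)
  then show ?case using Suc.IH by simp
qed simp

lemma alt_act_other: "i \<noteq> x \<Longrightarrow> i \<noteq> y \<Longrightarrow> alt_act x y k f i = f i"
  by (induction k arbitrary: x y f) (auto simp: reflect_other)

end

lemma alt_word_add:
  "alt_word s t (j + k) = alt_word s t j @ alt_word (if even j then s else t) (if even j then t else s) k"
  by (induction j arbitrary: s t) auto


section \<open>The action of the Artin group on chambers with coefficients\<close>

locale artin_parabolic = artin_graph +
  fixes T :: "'a set"
  assumes T_subset: "T \<subseteq> V"
begin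

abbreviation G :: "'a word set monoid" where "G \<equiv> artin_group V m"

abbreviation gen :: "'a \<Rightarrow> 'a word set" where "gen \<equiv> artin_gen V m"

definition cls :: "'a word \<Rightarrow> 'a word set" where
  "cls w = pres_rel V (artin_rels V m) `` {w}"

lemma group_G: "group G"
  unfolding artin_group_def by (rule group_presented_group)

lemma cls_carrier: "w \<in> words V \<Longrightarrow> cls w \<in> carrier G"
  unfolding cls_def artin_group_def presented_group_def by (simp add: quotientI)

lemma cls_append: "u \<in> words V \<Longrightarrow> v \<in> words V \<Longrightarrow> cls (u @ v) = cls u \<otimes>\<^bsub>G\<^esub> cls v"
  unfolding cls_def artin_group_def by (simp add: presented_group_mult)

lemma cls_Nil: "cls [] = \<one>\<^bsub>G\<^esub>"
  unfolding cls_def artin_group_def presented_group_def by simp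

lemma cls_gen: "cls [(s, True)] = gen s"
  unfolding cls_def artin_gen_def pres_gen_def ..

lemma cls_eq_iff:
  "u \<in> words V \<Longrightarrow> v \<in> words V \<Longrightarrow> cls u = cls v \<longleftrightarrow> (u, v) \<in> pres_rel V (artin_rels V m)"
  unfolding cls_def by (rule eq_equiv_class_iff[OF equiv_pres_rel])

lemma gen_carrier: "s \<in> V \<Longrightarrow> gen s \<in> carrier G"
  using cls_carrier[of "[(s, True)]"] by (simp add: cls_gen words_def)

lemma cls_inv_gen: assumes "s \<in> V" shows "cls [(s, False)] = inv\<^bsub>G\<^esub> (gen s)"
proof -
  interpret G: group G by (rule group_G)
  have w: "[(s, b)] \<in> words V" for b using assms by (simp add: words_def)
  have "([(s, False), (s, True)], []) \<in> pres_rel V (artin_rels V m)"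
    using pres_rel.cancel[OF assms, of False] by simp
  then have "cls ([(s, False)] @ [(s, True)]) = cls []"
    using w by (subst cls_eq_iff) (auto simp: words_def)
  then have "cls [(s, False)] \<otimes>\<^bsub>G\<^esub> gen s = \<one>\<^bsub>G\<^esub>"
    using w by (simp add: cls_append[symmetric] cls_gen[symmetric] cls_Nil)
  then show ?thesis using G.inv_equality[OF _ gen_carrier[OF assms] cls_carrier[OF w]] by simp
qed

definition letter :: "'a \<Rightarrow> bool \<Rightarrow> 'a word set" where
  "letter s b = (if b then gen s else inv\<^bsub>G\<^esub> (gen s))"

lemma cls_letter: "s \<in> V \<Longrightarrow> cls [(s, b)] = letter s b"
  by (simp add: letter_def cls_gen cls_inv_gen)

lemma letter_carrier: "s \<in> V \<Longrightarrow> letter s b \<in> carrier G"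
  by (simp add: letter_def gen_carrier group.inv_closed[OF group_G])

lemma letter_cancel:
  assumes "a \<in> carrier G" "s \<in> V" shows "a \<otimes>\<^bsub>G\<^esub> letter s b \<otimes>\<^bsub>G\<^esub> letter s (\<not> b) = a"
proof -
  interpret G: group G by (rule group_G)
  show ?thesis using assms gen_carrier[OF assms(2)] by (cases b) (simp_all add: letter_def G.m_assoc)
qed

text \<open>The inverses of the minimal representatives of the cosets \<open>W\<^sub>T w\<close>. Geometrically, these are
  the chambers of the Coxeter complex on the positive side of all walls of \<open>W\<^sub>T\<close>, where \<open>g\<close> stands
  for the translate of the fundamental chamber by \<open>g\<^sup>-\<^sup>1\<close>, and replacing \<open>g\<close> by \<open>s g\<close> means crossing
  the panel of type \<open>s\<close>.\<close>

definition chambers :: "(('a \<Rightarrow> real) \<Rightarrow> 'a \<Rightarrow> real) set" where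
  "chambers = {g \<in> weyl. \<forall>t\<in>T. \<forall>i. 0 \<le> g (simple_root t) i}"

text \<open>The panel of type \<open>s\<close> of the chamber \<open>g\<close> lies on the wall of the generator \<open>t\<close> of \<open>W\<^sub>T\<close>.\<close>

definition wall :: "(('a \<Rightarrow> real) \<Rightarrow> 'a \<Rightarrow> real) \<Rightarrow> 'a \<Rightarrow> 'a \<Rightarrow> bool" where
  "wall g s t \<longleftrightarrow> t \<in> T \<and> g (simple_root t) = simple_root s"

text \<open>Applied only when there is such a \<open>t\<close>, which is then unique by \<open>wall_unique\<close>.\<close>

definition label :: "(('a \<Rightarrow> real) \<Rightarrow> 'a \<Rightarrow> real) \<Rightarrow> 'a \<Rightarrow> 'a" where
  "label g s = (SOME t. wall g s t)"

definition step :: "'a \<times> bool \<Rightarrow> (('a \<Rightarrow> real) \<Rightarrow> 'a \<Rightarrow> real) \<times> 'a word set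
    \<Rightarrow> (('a \<Rightarrow> real) \<Rightarrow> 'a \<Rightarrow> real) \<times> 'a word set" where
  "step = (\<lambda>(s, b) (g, a). if \<exists>t. wall g s t then (g, a \<otimes>\<^bsub>G\<^esub> letter (label g s) b)
     else (reflect s \<circ> g, a))"

abbreviation run :: "'a word \<Rightarrow> (('a \<Rightarrow> real) \<Rightarrow> 'a \<Rightarrow> real) \<times> 'a word set
    \<Rightarrow> (('a \<Rightarrow> real) \<Rightarrow> 'a \<Rightarrow> real) \<times> 'a word set" where
  "run \<equiv> fold step"

lemma chambers_weyl: "g \<in> chambers \<Longrightarrow> g \<in> weyl"
  by (simp add: chambers_def)

lemma wall_unique: "g \<in> chambers \<Longrightarrow> wall g s t \<Longrightarrow> wall g s t' \<Longrightarrow> t = t'"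
  unfolding wall_def using weyl_inject[OF chambers_weyl, of g "simple_root t" "simple_root t'"] by simp

lemma step_wall:
  assumes "g \<in> chambers" "wall g s t"
  shows "step (s, b) (g, a) = (g, a \<otimes>\<^bsub>G\<^esub> letter t b)"
proof -
  have "label g s = t"
    unfolding label_def using assms wall_unique by (intro some_equality) auto
  then show ?thesis using assms by (auto simp: step_def)
qed

lemma step_no_wall: "\<nexists>t. wall g s t \<Longrightarrow> step (s, b) (g, a) = (reflect s \<circ> g, a)"
  unfolding step_def by (simp only: case_prod_conv if_False)

text \<open>A reflection changes a single coordinate. So if \<open>s\<close> makes a nonnegative root negative, this root
  is supported at \<open>s\<close>, hence equal to \<open>\<alpha>\<^sub>s\<close>.\<close>

lemma chambers_reflect:
  assumes g: "g \<in> chambers" and s: "s \<in> V" and nw: "\<nexists>t. wall g s t"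
  shows "reflect s \<circ> g \<in> chambers"
proof -
  have gw: "g \<in> weyl" by (rule chambers_weyl[OF g])
  then have w: "reflect s \<circ> g \<in> weyl" using s by (simp add: weyl_comp weyl_reflect)
  have "0 \<le> (reflect s \<circ> g) (simple_root t) i" if t: "t \<in> T" for t i
  proof (rule ccontr)
    assume neg: "\<not> 0 \<le> (reflect s \<circ> g) (simple_root t) i"
    have tV: "t \<in> V" using t T_subset by blast
    have pos: "0 \<le> g (simple_root t) j" for j using g t by (simp add: chambers_def)
    have "(reflect s \<circ> g) (simple_root t) j \<le> 0" for j
      using root_pos_or_neg[OF w tV] neg by blast
    then have "g (simple_root t) j = 0" if "j \<noteq> s" for j
      using reflect_other[OF that, of "g (simple_root t)"] pos[of j] by (metis antisym comp_apply)
    then have m: "g (simple_root t) = (\<lambda>j. g (simple_root t) s * simple_root s j)"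
      by (auto simp: fun_eq_iff simple_root_def)
    then have "g (simple_root t) s = 1" using weyl_unit_multiple[OF gw tV s m pos] by simp
    then have "wall g s t" using m t by (simp add: wall_def)
    then show False using nw by blast
  qed
  then show ?thesis using w by (simp add: chambers_def)
qed

text \<open>Crossing a panel leads to a chamber from which the same panel can be crossed back; otherwise
  \<open>g\<close> would send a simple root of \<open>T\<close> to \<open>- \<alpha>\<^sub>s\<close>.\<close>

lemma no_wall_reflect:
  assumes g: "g \<in> chambers" and s: "s \<in> V" shows "\<nexists>t. wall (reflect s \<circ> g) s t"
proof
  assume "\<exists>t. wall (reflect s \<circ> g) s t"
  then obtain t where t: "t \<in> T" "reflect s (g (simple_root t)) = simple_root s"
    by (auto simp: wall_def)
  then have "g (simple_root t) = reflect s (simple_root s)" using reflect_reflect[OF s] by metis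
  then have "g (simple_root t) s = - simple_root s s" unfolding reflect_root_self[OF s] by metis
  then have "g (simple_root t) s = - 1" by (simp add: simple_root_def)
  moreover have "0 \<le> g (simple_root t) s" using g t(1) by (simp add: chambers_def)
  ultimately show False by simp
qed

lemma step_closed:
  assumes "g \<in> chambers" "a \<in> carrier G" "s \<in> V"
  shows "step (s, b) (g, a) \<in> chambers \<times> carrier G"
proof (cases "\<exists>t. wall g s t")
  case True
  then obtain t where t: "wall g s t" by blast
  then have "t \<in> V" using T_subset by (auto simp: wall_def)
  then have "a \<otimes>\<^bsub>G\<^esub> letter t b \<in> carrier G"
    by (intro monoid.m_closed[OF group.is_monoid[OF group_G]] assms(2) letter_carrier)
  then show ?thesis unfolding step_wall[OF assms(1) t] using assms(1) by simp
next
  case False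
  then show ?thesis
    unfolding step_no_wall[OF False] using assms(2) chambers_reflect[OF assms(1,3)] by blast
qed

lemma run_closed:
  assumes "w \<in> words V" "p \<in> chambers \<times> carrier G"
  shows "run w p \<in> chambers \<times> carrier G"
  using assms
proof (induction w arbitrary: p)
  case (Cons l w)
  obtain s b where l: "l = (s, b)" by (cases l)
  have s: "s \<in> V" and w: "w \<in> words V" using Cons.prems(1) by (auto simp: words_def l)
  obtain g a where p: "p = (g, a)" by (cases p)
  have "step l p \<in> chambers \<times> carrier G"
    unfolding l p using Cons.prems(2) s by (intro step_closed) (auto simp: p)
  from Cons.IH[OF w this] show ?case by simp
qed simp

lemma step_cancel:
  assumes "g \<in> chambers" "a \<in> carrier G" "s \<in> V"
  shows "step (s, \<not> b) (step (s, b) (g, a)) = (g, a)"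
proof (cases "\<exists>t. wall g s t")
  case True
  then obtain t where t: "wall g s t" by blast
  then have "t \<in> V" using T_subset by (auto simp: wall_def)
  then show ?thesis unfolding step_wall[OF assms(1) t] by (simp only: letter_cancel[OF assms(2)])
next
  case False
  then show ?thesis
    unfolding step_no_wall[OF False] step_no_wall[OF no_wall_reflect[OF assms(1,3)]]
    by (simp only: reflect_comp[OF assms(3)])
qed

lemma run_free:
  assumes "g \<in> chambers" "x \<in> V" "y \<in> V"
    and "\<And>j. j < k \<Longrightarrow> \<nexists>t. wall (alt_act x y j \<circ> g) (if even j then x else y) t"
  shows "run (alt_word x y k) (g, a) = (alt_act x y k \<circ> g, a)" and "alt_act x y k \<circ> g \<in> chambers"
proof -
  have "run (alt_word x y k) (g, a) = (alt_act x y k \<circ> g, a) \<and> alt_act x y k \<circ> g \<in> chambers"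
    using assms
  proof (induction k arbitrary: x y g)
    case 0 then show ?case by (simp add: comp_def)
  next
    case (Suc k)
    have shift: "alt_act x y (Suc j) \<circ> g = alt_act y x j \<circ> (reflect x \<circ> g)" for j
      by (simp add: fun_eq_iff)
    have g0: "\<nexists>t. wall g x t" using Suc.prems(4)[of 0] by (simp add: comp_def)
    have "\<nexists>t. wall (alt_act y x j \<circ> (reflect x \<circ> g)) (if even j then y else x) t" if "j < k" for j
    proof -
      have parity: "(if even (Suc j) then x else y) = (if even j then y else x)" by simp
      show ?thesis using Suc.prems(4)[of "Suc j"] that unfolding shift parity by blast
    qed
    moreover have "run (alt_word x y (Suc k)) (g, a) = run (alt_word y x k) (reflect x \<circ> g, a)"
      by (simp only: alt_word.simps fold_simps step_no_wall[OF g0])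
    ultimately show ?case
      using Suc.IH[OF chambers_reflect[OF Suc.prems(1,2) g0] Suc.prems(3,2)] unfolding shift by metis
  qed
  then show "run (alt_word x y k) (g, a) = (alt_act x y k \<circ> g, a)" "alt_act x y k \<circ> g \<in> chambers"
    by blast+
qed

lemma alt_word_words: "x \<in> V \<Longrightarrow> y \<in> V \<Longrightarrow> alt_word x y k \<in> words V"
  by (induction k arbitrary: x y) (auto simp: words_def)

lemma run_two_walls:
  assumes g: "g \<in> chambers" and a: "a \<in> carrier G" and w: "wall g x t" "wall g y t'"
  shows "run (alt_word x y k) (g, a) = (g, a \<otimes>\<^bsub>G\<^esub> cls (alt_word t t' k))"
proof -
  interpret G: group G by (rule group_G)
  show ?thesis using a w
  proof (induction k arbitrary: x y t t' a)
    case 0 then show ?case by (simp add: cls_Nil)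
  next
    case (Suc k)
    have t: "t \<in> V" "t' \<in> V" using Suc.prems T_subset by (auto simp: wall_def)
    have "cls (alt_word t t' (Suc k)) = gen t \<otimes>\<^bsub>G\<^esub> cls (alt_word t' t k)"
      using cls_append[of "[(t, True)]" "alt_word t' t k"] t alt_word_words[OF t(2,1)]
      by (simp add: cls_gen words_def)
    moreover have "run (alt_word x y (Suc k)) (g, a) = run (alt_word y x k) (g, a \<otimes>\<^bsub>G\<^esub> gen t)"
      by (simp add: step_wall[OF g Suc.prems(2)] letter_def)
    moreover have "a \<otimes>\<^bsub>G\<^esub> gen t \<otimes>\<^bsub>G\<^esub> cls (alt_word t' t k)
        = a \<otimes>\<^bsub>G\<^esub> (gen t \<otimes>\<^bsub>G\<^esub> cls (alt_word t' t k))"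
      using Suc.prems(1) gen_carrier[OF t(1)] cls_carrier[OF alt_word_words[OF t(2,1)]] by (rule G.m_assoc)
    ultimately show ?case
      using Suc.IH[OF G.m_closed[OF Suc.prems(1) gen_carrier[OF t(1)]] Suc.prems(3,2)] by metis
  qed
qed

text \<open>Since \<open>g\<close> preserves the bilinear form, the two walls form the same angle as the two panels.\<close>

lemma two_walls_label:
  assumes g: "g \<in> chambers" and w: "wall g x t" "wall g y t'" and xy: "x \<in> V" "y \<in> V" "x \<noteq> y"
  shows "t \<in> V" "t' \<in> V" "t \<noteq> t'" "m t t' = m x y"
proof -
  show t: "t \<in> V" "t' \<in> V" using w T_subset by (auto simp: wall_def)
  show neq: "t \<noteq> t'" using w xy by (auto simp: wall_def)
  have "form (simple_root t) (simple_root t') = form (simple_root x) (simple_root y)"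
    using weyl_form[OF chambers_weyl[OF g], of "simple_root t" "simple_root t'"] w by (simp add: wall_def)
  then have "coef t t' = coef x y"
    using t neq xy by (simp add: form_root pairing_root gram_def)
  then show "m t t' = m x y" using t neq xy by (intro coef_inject)
qed

section \<open>Braid relations along a dihedral gallery\<close>

text \<open>Here \<open>g\<close> is a chamber whose panel of type \<open>x\<close> lies on a wall, with label \<open>t\<close>, while its panel
  of type \<open>y\<close> does not. Crossing panels of types \<open>y, x, y, \<dots>\<close> gives a gallery. It runs freely
  through \<open>n\<close> chambers, and the panel that comes next in the last one lies again on the wall of
  \<open>t\<close>. Both sides of the braid relation then walk along this path, are reflected once at one of the
  ends, where they pick up the factor \<open>t\<close>, and stop at the same chamber.\<close>

context
  fixes g :: "('a \<Rightarrow> real) \<Rightarrow> 'a \<Rightarrow> real" and x y t :: 'a and n :: nat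
  assumes g: "g \<in> chambers" and xy: "x \<in> V" "y \<in> V" "x \<noteq> y" and mxy: "m x y = enat n"
    and wall_x: "wall g x t" and no_wall_y: "\<nexists>t'. wall g y t'"
begin

abbreviation gallery :: "nat \<Rightarrow> ('a \<Rightarrow> real) \<Rightarrow> 'a \<Rightarrow> real" where
  "gallery k \<equiv> alt_act y x k \<circ> g"

text \<open>The type of the panel between the chambers number \<open>k\<close> and \<open>k + 1\<close>; thus \<open>nxt (Suc k)\<close> is the type
  of the panel between the chambers number \<open>k - 1\<close> and \<open>k\<close>, and \<open>nxt 1 = x\<close> is that of the wall at the
  beginning.\<close>

abbreviation nxt :: "nat \<Rightarrow> 'a" where
  "nxt k \<equiv> (if even k then y else x)"

lemma gallery_wall_root:
  "gallery k (simple_root t) = (\<lambda>i. cheb (coef x y) (Suc k) * simple_root (nxt (Suc k)) i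
     + cheb (coef x y) k * simple_root (nxt k) i)"
  using wall_x unfolding wall_def by (simp add: alt_act_root[OF xy])

text \<open>A second root \<open>g \<alpha>\<^sub>t\<^sub>'\<close> in the plane of \<open>\<alpha>\<^sub>x\<close> and \<open>\<alpha>\<^sub>y\<close> would be \<open>a \<alpha>\<^sub>x + b \<alpha>\<^sub>y\<close> with
  \<open>a, b \<ge> 0\<close>. Then the root \<open>g\<^sup>-\<^sup>1 \<alpha>\<^sub>y\<close> is \<open>(\<alpha>\<^sub>t\<^sub>' - a \<alpha>\<^sub>t) / b\<close>, and having coordinates of one sign
  it forces \<open>a = 0\<close>. Comparing lengths gives \<open>b = 1\<close>, so \<open>g \<alpha>\<^sub>t\<^sub>' = \<alpha>\<^sub>y\<close>, against the assumption on
  \<open>y\<close>.\<close>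

lemma no_second_wall:
  assumes t': "t' \<in> T" "t' \<noteq> t"
    and plane: "\<And>i. i \<noteq> x \<Longrightarrow> i \<noteq> y \<Longrightarrow> g (simple_root t') i = 0"
  shows False
proof -
  have gw: "g \<in> weyl" by (rule chambers_weyl[OF g])
  have tV: "t \<in> V" "t' \<in> V" using wall_x t' T_subset by (auto simp: wall_def)
  have gt: "g (simple_root t) = simple_root x" using wall_x by (simp add: wall_def)
  define a b where "a = g (simple_root t') x" and "b = g (simple_root t') y"
  have ab: "0 \<le> a" "0 \<le> b" using g t'(1) by (simp_all add: a_def b_def chambers_def)
  have gt': "g (simple_root t') = (\<lambda>i. a * simple_root x i + b * simple_root y i)"
    using plane xy by (auto simp: fun_eq_iff a_def b_def simple_root_def)
  obtain v where v: "v \<in> weyl" "v \<circ> g = id" using weyl_inverse[OF gw] by metis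
  have vg: "v (g f) = f" for f using v(2) by (simp add: fun_eq_iff)
  define r where "r = v (simple_root y)"
  have "simple_root t' = v (g (simple_root t'))" by (simp add: vg)
  also have "\<dots> = (\<lambda>i. a * simple_root t i + b * r i)"
    unfolding gt' linD[OF weyl_lin[OF v(1)]] r_def vg[of "simple_root t", unfolded gt] ..
  finally have e: "simple_root t' i = a * simple_root t i + b * r i" for i by metis
  have 1: "b * r t' = 1" using e[of t'] t'(2) by (simp add: simple_root_def)
  have 2: "a + b * r t = 0" using e[of t] t'(2) by (simp add: simple_root_def)
  have "0 < b * r t'" by (simp add: 1)
  then have "0 < r t'" using ab(2) unfolding zero_less_mult_iff by linarith
  then have "0 \<le> r t" using root_pos_or_neg[OF v(1) xy(2)] unfolding r_def by (metis not_le)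
  then have "a = 0" using 2 ab mult_nonneg_nonneg[of b "r t"] by linarith
  then have gb: "g (simple_root t') = (\<lambda>i. b * simple_root y i)" using gt' by simp
  then have "b = 1" using weyl_unit_multiple[OF gw tV(2) xy(2) gb ab(2)] by simp
  then have "wall g y t'" using gb t'(1) by (simp add: wall_def)
  then show False using no_wall_y by blast
qed

text \<open>A wall met on the way belongs to a root in the plane of \<open>\<alpha>\<^sub>x\<close> and \<open>\<alpha>\<^sub>y\<close>. By \<open>no_second_wall\<close> this
  is the root of \<open>t\<close>, but before the end of the gallery its coefficient at \<open>nxt (Suc k)\<close> is positive, so
  it is not the simple root of \<open>nxt k\<close>.\<close>

lemma gallery_no_wall:
  assumes k: "k < n - 1" shows "\<nexists>t'. wall (gallery k) (nxt k) t'"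
proof
  assume "\<exists>t'. wall (gallery k) (nxt k) t'"
  then obtain t' where t': "t' \<in> T" "gallery k (simple_root t') = simple_root (nxt k)"
    by (auto simp: wall_def)
  show False
  proof (cases "t' = t")
    case True
    have ne: "nxt (Suc k) \<noteq> nxt k" using xy by auto
    have "cheb (coef x y) (Suc k) = 0"
      using fun_cong[OF t'(2)[unfolded True gallery_wall_root], of "nxt (Suc k)"] ne
      unfolding simple_root_def by auto
    moreover have "Suc k < n" using k by linarith
    ultimately show False using cheb_edge_pos[OF mxy xy, of "Suc k"] by simp
  next
    case False
    have "g (simple_root t') i = 0" if "i \<noteq> x" "i \<noteq> y" for i
    proof -
      have "g (simple_root t') i = gallery k (simple_root t') i" using that by (simp add: alt_act_other)
      also have "\<dots> = 0" unfolding t'(2) using that by (simp add: simple_root_def)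
      finally show ?thesis .
    qed
    from no_second_wall[OF t'(1) False this] show False .
  qed
qed

lemma gallery_end: "wall (gallery (n - 1)) (nxt (n - 1)) t"
proof -
  have "Suc (n - 1) = n" using coef_edge(1)[OF mxy xy] by simp
  then have "gallery (n - 1) (simple_root t) = simple_root (nxt (n - 1))"
    unfolding gallery_wall_root
    using cheb_edge_zero[OF mxy xy] cheb_edge_last[OF mxy xy] by simp
  then show ?thesis using wall_x by (simp add: wall_def)
qed

lemma gallery_Suc: "gallery (Suc k) = reflect (nxt k) \<circ> gallery k"
  unfolding alt_act_last_comp by (rule comp_assoc)

lemma gallery_chambers: "k \<le> n - 1 \<Longrightarrow> gallery k \<in> chambers"
proof (induction k)
  case 0
  have "gallery 0 = g" by (simp add: fun_eq_iff)
  then show ?case using g by metis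
next
  case (Suc k)
  have "nxt k \<in> V" using xy by simp
  moreover have "gallery k \<in> chambers" using Suc.prems by (intro Suc.IH) simp
  moreover have "k < n - 1" using Suc.prems by simp
  ultimately show ?case unfolding gallery_Suc using chambers_reflect gallery_no_wall by blast
qed

lemma step_gallery_up: "k < n - 1 \<Longrightarrow> step (nxt k, b) (gallery k, a) = (gallery (Suc k), a)"
  unfolding gallery_Suc by (rule step_no_wall[OF gallery_no_wall])

text \<open>A positive letter also leads backwards, because it undoes what the inverse letter does on the
  way up.\<close>

lemma step_gallery_down:
  assumes "k < n - 1" "a \<in> carrier G"
  shows "step (nxt k, True) (gallery (Suc k), a) = (gallery k, a)"
proof -
  have "nxt k \<in> V" using xy by simp
  moreover have "gallery k \<in> chambers" using assms(1) by (intro gallery_chambers) simp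
  ultimately show ?thesis
    using step_cancel[of "gallery k" a "nxt k" False] assms(2) unfolding step_gallery_up[OF assms(1)] by simp
qed

lemma run_gallery_up:
  "i + j \<le> n - 1 \<Longrightarrow> run (alt_word (nxt i) (nxt (Suc i)) j) (gallery i, a) = (gallery (i + j), a)"
proof (induction j arbitrary: i)
  case (Suc j)
  have "nxt (Suc (Suc i)) = nxt i" by simp
  then have "run (alt_word (nxt i) (nxt (Suc i)) (Suc j)) (gallery i, a)
      = run (alt_word (nxt (Suc i)) (nxt (Suc (Suc i))) j) (gallery (Suc i), a)"
    using Suc.prems step_gallery_up[of i True a] by (simp only: alt_word.simps fold_simps)
  also have "\<dots> = (gallery (Suc i + j), a)" using Suc.prems by (intro Suc.IH) simp
  finally show ?case by (simp only: add_Suc add_Suc_right)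
qed simp

lemma run_gallery_down:
  assumes "a \<in> carrier G"
  shows "i \<le> n - 1 \<Longrightarrow> j \<le> i \<Longrightarrow>
    run (alt_word (nxt (Suc i)) (nxt i) j) (gallery i, a) = (gallery (i - j), a)"
proof (induction j arbitrary: i)
  case (Suc j)
  obtain k where k: "i = Suc k" using Suc.prems by (cases i) auto
  have "nxt (Suc (Suc k)) = nxt k" by simp
  then have "run (alt_word (nxt (Suc i)) (nxt i) (Suc j)) (gallery i, a)
      = run (alt_word (nxt (Suc k)) (nxt k) j) (gallery k, a)"
    unfolding k using Suc.prems step_gallery_down[of k a] assms k
    by (simp only: alt_word.simps fold_simps)
  also have "\<dots> = (gallery (k - j), a)" using Suc.prems k by (intro Suc.IH) simp_all
  finally show ?case by (simp only: k diff_Suc_Suc)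
qed simp

lemma braid_gallery:
  assumes i: "i \<le> n - 1" and a: "a \<in> carrier G"
  shows "run (alt_word (nxt i) (nxt (Suc i)) n) (gallery i, a)
    = run (alt_word (nxt (Suc i)) (nxt i) n) (gallery i, a)"
proof -
  have n: "Suc (n - 1) = n" using coef_edge(1)[OF mxy xy] by simp
  have tV: "t \<in> V" using wall_x T_subset by (auto simp: wall_def)
  define b where "b = a \<otimes>\<^bsub>G\<^esub> gen t"
  have b: "b \<in> carrier G"
    unfolding b_def by (intro monoid.m_closed[OF group.is_monoid[OF group_G]] a gen_carrier tV)
  define j where "j = n - 1 - i"
  have ij: "i + j = n - 1" using i by (simp add: j_def)
  have g0: "gallery 0 = g" by (simp add: fun_eq_iff)

  \<comment> \<open>Up \<open>j\<close> steps to the end, one reflection there, and down \<open>i\<close> steps.\<close>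
  have "alt_word (nxt i) (nxt (Suc i)) n = alt_word (nxt i) (nxt (Suc i)) j
      @ alt_word (nxt (n - 1)) (nxt (Suc (n - 1))) (Suc i)"
  proof -
    have len: "j + Suc i = n" using ij n by simp
    have parity: "(if even j then nxt i else nxt (Suc i)) = nxt (n - 1)"
      "(if even j then nxt (Suc i) else nxt i) = nxt (Suc (n - 1))"
      unfolding ij[symmetric] by simp_all
    show ?thesis using alt_word_add[of "nxt i" "nxt (Suc i)" j "Suc i"] unfolding parity len .
  qed
  then have "run (alt_word (nxt i) (nxt (Suc i)) n) (gallery i, a)
      = run (alt_word (nxt (n - 1)) (nxt (Suc (n - 1))) (Suc i)) (gallery (n - 1), a)"
    using run_gallery_up[of i j a] ij by simp
  also have "\<dots> = run (alt_word (nxt (Suc (n - 1))) (nxt (n - 1)) i) (gallery (n - 1), b)"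
    using step_wall[OF gallery_chambers[OF order.refl] gallery_end, of True a]
    by (simp only: alt_word.simps fold_simps) (simp add: b_def letter_def)
  also have "\<dots> = (gallery (n - 1 - i), b)" by (rule run_gallery_down[OF b order.refl i])
  finally have up: "run (alt_word (nxt i) (nxt (Suc i)) n) (gallery i, a) = (gallery j, b)"
    by (simp only: j_def)

  \<comment> \<open>Down \<open>i\<close> steps to the beginning, one reflection there, and up \<open>j\<close> steps.\<close>
  have "alt_word (nxt (Suc i)) (nxt i) n = alt_word (nxt (Suc i)) (nxt i) i
      @ alt_word (nxt (Suc 0)) (nxt 0) (Suc j)"
  proof -
    have len: "i + Suc j = n" using ij n by simp
    have parity: "(if even i then nxt (Suc i) else nxt i) = nxt (Suc 0)"
      "(if even i then nxt i else nxt (Suc i)) = nxt 0" by simp_all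
    show ?thesis using alt_word_add[of "nxt (Suc i)" "nxt i" i "Suc j"] unfolding parity len .
  qed
  then have "run (alt_word (nxt (Suc i)) (nxt i) n) (gallery i, a)
      = run (alt_word (nxt (Suc 0)) (nxt 0) (Suc j)) (gallery 0, a)"
    using run_gallery_down[OF a i order.refl] by simp
  also have "\<dots> = run (alt_word (nxt 0) (nxt (Suc 0)) j) (gallery 0, b)"
    unfolding g0 using step_wall[OF g wall_x, of True a]
    by (simp only: alt_word.simps fold_simps) (simp add: b_def letter_def)
  also have "\<dots> = (gallery (0 + j), b)" using ij by (intro run_gallery_up) simp
  finally show ?thesis using up by simp
qed

end

lemma artin_relation:
  assumes "s \<in> V" "t \<in> V" "s \<noteq> t" "m s t = enat n"
  shows "cls (alt_word s t n) = cls (alt_word t s n)"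
proof -
  have "(alt_word s t n, alt_word t s n) \<in> artin_rels V m"
    unfolding artin_rels_def edges_def using assms by auto
  then show ?thesis
    using assms by (subst cls_eq_iff) (auto intro!: alt_word_words pres_rel.base)
qed

text \<open>The first chamber \<open>h\<close> with a wall ahead, reached after \<open>N\<close> steps, is blocked by both generators
  or only by one. In the former case \<open>N = 0\<close>, because the panel just crossed is not on a wall. In the
  latter case \<open>g\<close> is the chamber number \<open>N\<close> of the gallery that starts at \<open>h\<close>.\<close>

lemma braid_run_wall:
  assumes g: "g \<in> chambers" and a: "a \<in> carrier G" and st: "s \<in> V" "s' \<in> V" "s \<noteq> s'" "m s s' = enat n"
    and N: "N < n" and wall_N: "wall (alt_act s s' N \<circ> g) (if even N then s else s') t"
    and free: "\<And>j. j < N \<Longrightarrow> \<nexists>t. wall (alt_act s s' j \<circ> g) (if even j then s else s') t"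
  shows "run (alt_word s s' n) (g, a) = run (alt_word s' s n) (g, a)"
proof -
  define h where "h = alt_act s s' N \<circ> g"
  define x where "x = (if even N then s else s')"
  define y where "y = (if even N then s' else s)"
  have h: "h \<in> chambers" unfolding h_def by (rule run_free(2)[OF g st(1,2) free])
  have xy: "x \<in> V" "y \<in> V" "x \<noteq> y" "m x y = enat n" using st m_sym by (auto simp: x_def y_def)
  have wall_h: "wall h x t" using wall_N by (simp only: h_def x_def)
  show ?thesis
  proof (cases "\<exists>t'. wall h y t'")
    case True
    then obtain t' where t': "wall h y t'" by blast
    have "N = 0"
    proof (rule ccontr)
      assume "N \<noteq> 0"
      then obtain M where M: "N = Suc M" by (cases N) auto
      have h': "alt_act s s' M \<circ> g \<in> chambers" by (rule run_free(2)[OF g st(1,2)]) (simp add: free M)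
      have "h = reflect y \<circ> (alt_act s s' M \<circ> g)"
        unfolding h_def M alt_act_last_comp by (simp add: y_def M comp_assoc)
      then show False using no_wall_reflect[OF h' xy(2)] t' by metis
    qed
    then have hg: "h = g" "x = s" "y = s'" by (simp_all add: h_def x_def y_def fun_eq_iff)
    have w: "wall g s t" "wall g s' t'" using wall_h t' hg by simp_all
    note lab = two_walls_label[OF g w st(1-3)]
    show ?thesis
      unfolding run_two_walls[OF g a w] run_two_walls[OF g a w(2,1)]
      using artin_relation[OF lab(1-3)] lab(4) st(4) by simp
  next
    case False
    have undo: "alt_act y x N \<circ> h = g"
      using alt_act_undo[OF st(1,2), of N] by (simp add: fun_eq_iff h_def x_def y_def)
    have st_eq: "s = (if even (Suc N) then y else x)" "s' = (if even N then y else x)"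
      by (auto simp: x_def y_def)
    show ?thesis
      using braid_gallery[OF h xy(1-4) wall_h False _ a, of N] N unfolding undo st_eq[symmetric] by simp
  qed
qed

text \<open>If neither side of the relation meets a wall within \<open>n\<close> steps, then both act by
  the same element of the Coxeter group.\<close>

lemma braid_run:
  assumes g: "g \<in> chambers" and a: "a \<in> carrier G" and st: "s \<in> V" "s' \<in> V" "s \<noteq> s'" "m s s' = enat n"
  shows "run (alt_word s s' n) (g, a) = run (alt_word s' s n) (g, a)"
proof -
  have hit: "run (alt_word s s' n) (g, a) = run (alt_word s' s n) (g, a)"
    if st: "s \<in> V" "s' \<in> V" "s \<noteq> s'" "m s s' = enat n" and
      wall: "\<exists>j<n. \<exists>t. wall (alt_act s s' j \<circ> g) (if even j then s else s') t" for s s'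
  proof -
    define P where "P j \<longleftrightarrow> (\<exists>t. wall (alt_act s s' j \<circ> g) (if even j then s else s') t)" for j
    obtain j where j: "j < n" "P j" using wall unfolding P_def by blast
    define N where "N = (LEAST j. P j)"
    have "P N" unfolding N_def by (rule LeastI[of P, OF j(2)])
    then obtain t where t: "wall (alt_act s s' N \<circ> g) (if even N then s else s') t"
      unfolding P_def by blast
    have "N < n" using Least_le[of P, OF j(2)] j(1) unfolding N_def by simp
    moreover have "\<not> P j" if "j < N" for j using not_less_Least[of j P] that unfolding N_def by blast
    ultimately show ?thesis using braid_run_wall[OF g a st _ t] unfolding P_def by blast
  qed
  have m': "m s' s = enat n" using st m_sym by simp
  show ?thesis
  proof (cases "(\<exists>j<n. \<exists>t. wall (alt_act s s' j \<circ> g) (if even j then s else s') t)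
      \<or> (\<exists>j<n. \<exists>t. wall (alt_act s' s j \<circ> g) (if even j then s' else s) t)")
    case True
    then show ?thesis using hit[OF st] hit[OF st(2,1) st(3)[symmetric] m'] by metis
  next
    case False
    then have "run (alt_word s s' n) (g, a) = (alt_act s s' n \<circ> g, a)"
      "run (alt_word s' s n) (g, a) = (alt_act s' s n \<circ> g, a)"
      using run_free(1)[OF g st(1,2), of n a] run_free(1)[OF g st(2,1), of n a] by blast+
    moreover have "alt_act s s' n = alt_act s' s n" by (rule ext) (rule braid_alt_act[OF st(4,1,2,3)])
    ultimately show ?thesis by simp
  qed
qed

lemma run_pres_rel:
  assumes "(u, v) \<in> pres_rel V (artin_rels V m)" "g \<in> chambers" "a \<in> carrier G"
  shows "run u (g, a) = run v (g, a)"
  using assms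
proof (induction arbitrary: g a)
  case (base u v)
  then obtain s t n where "u = alt_word s t n" "v = alt_word t s n" "(s, t) \<in> edges V m" "m s t = enat n"
    unfolding artin_rels_def by blast
  then show ?case using braid_run[OF base.prems, of s t n] by (simp add: edges_def)
next
  case (cancel s b)
  then show ?case using step_cancel[of g a s b] by simp
next
  case (append u v u' v')
  have "run u (g, a) \<in> chambers \<times> carrier G"
    using append.prems pres_rel_words[OF append.hyps(1)] by (intro run_closed) auto
  then obtain g' a' where p: "run u (g, a) = (g', a')" "g' \<in> chambers" "a' \<in> carrier G" by blast
  have "run v (g, a) = (g', a')" using append.IH(1)[OF append.prems] p(1) by simp
  then show ?case using p append.IH(2)[OF p(2,3)] by simp
qed simp_all


section \<open>Weak malnormality\<close>

lemma std_parabolic_word: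
  "a \<in> std_parabolic V m T \<Longrightarrow> \<exists>w\<in>words T. a = cls w"
  unfolding std_parabolic_def
proof (induction rule: generate.induct)
  case one
  show ?case by (rule bexI[of _ "[]"]) (simp_all add: cls_Nil words_def)
next
  case (incl h)
  then obtain s where "s \<in> T" "h = gen s" by blast
  then show ?case by (intro bexI[of _ "[(s, True)]"]) (simp_all add: cls_gen words_def)
next
  case (inv h)
  then obtain s where "s \<in> T" "h = gen s" by blast
  moreover from this have "s \<in> V" using T_subset by blast
  ultimately show ?case by (intro bexI[of _ "[(s, False)]"]) (simp_all add: cls_inv_gen words_def)
next
  case (eng h1 h2)
  then obtain u v where uv: "u \<in> words T" "v \<in> words T" "h1 = cls u" "h2 = cls v" by blast
  then have "u \<in> words V" "v \<in> words V" using T_subset by (auto simp: words_def)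
  then have "h1 \<otimes>\<^bsub>G\<^esub> h2 = cls (u @ v)" using uv by (simp add: cls_append)
  moreover have "u @ v \<in> words T" using uv by (simp add: words_def)
  ultimately show ?case by blast
qed

lemma id_chambers: "id \<in> chambers"
  by (simp add: chambers_def weyl_id simple_root_def)

lemma run_id:
  assumes "w \<in> words T" "a \<in> carrier G"
  shows "run w (id, a) = (id, a \<otimes>\<^bsub>G\<^esub> cls w)"
  using assms
proof (induction w arbitrary: a)
  case Nil
  then show ?case by (simp add: cls_Nil monoid.r_one[OF group.is_monoid[OF group_G]])
next
  case (Cons l w)
  interpret G: group G by (rule group_G)
  obtain s b where l: "l = (s, b)" by (cases l)
  have s: "s \<in> T" and w: "w \<in> words T" using Cons.prems(1) by (auto simp: words_def l)
  have sV: "s \<in> V" and wV: "w \<in> words V" using s w T_subset by (auto simp: words_def)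
  have "wall id s s" using s by (simp add: wall_def)
  then have "run (l # w) (id, a) = run w (id, a \<otimes>\<^bsub>G\<^esub> letter s b)"
    unfolding l fold_simps by (simp only: step_wall[OF id_chambers])
  also have "\<dots> = (id, a \<otimes>\<^bsub>G\<^esub> letter s b \<otimes>\<^bsub>G\<^esub> cls w)"
    by (rule Cons.IH[OF w]) (simp add: Cons.prems letter_carrier[OF sV])
  also have "a \<otimes>\<^bsub>G\<^esub> letter s b \<otimes>\<^bsub>G\<^esub> cls w = a \<otimes>\<^bsub>G\<^esub> cls (l # w)"
    using Cons.prems(2) letter_carrier[OF sV, of b] cls_carrier[OF wV] cls_append[of "[(s, b)]" w] sV wV
    by (simp add: l cls_letter words_def G.m_assoc)
  finally show ?case .
qed

text \<open>Reflections in \<open>T\<close> preserve the \<open>u\<close>-coordinate, and as long as it does not vanish on any image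
  \<open>g \<alpha>\<^sub>t\<close>, no such image is a simple root of \<open>T\<close>.\<close>

lemma run_away:
  assumes "w \<in> words T" "u \<notin> T" "\<And>t. t \<in> T \<Longrightarrow> g (simple_root t) u \<noteq> 0"
  shows "snd (run w (g, a)) = a"
  using assms
proof (induction w arbitrary: g)
  case (Cons l w)
  obtain s b where l: "l = (s, b)" by (cases l)
  have s: "s \<in> T" and w: "w \<in> words T" using Cons.prems(1) by (auto simp: words_def l)
  have su: "u \<noteq> s" using s Cons.prems(2) by blast
  have nw: "\<nexists>t. wall g s t"
  proof
    assume "\<exists>t. wall g s t"
    then obtain t where "t \<in> T" "g (simple_root t) = simple_root s" by (auto simp: wall_def)
    then show False using Cons.prems(3)[of t] su by (simp add: simple_root_def)
  qed
  have "run (l # w) (g, a) = run w (reflect s \<circ> g, a)"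
    unfolding l fold_simps step_no_wall[OF nw] ..
  moreover have "snd (run w (reflect s \<circ> g, a)) = a"
  proof (rule Cons.IH[OF w Cons.prems(2)])
    show "(reflect s \<circ> g) (simple_root t) u \<noteq> 0" if "t \<in> T" for t
      unfolding o_apply reflect_other[OF su] by (rule Cons.prems(3)[OF that])
  qed
  ultimately show ?case by simp
qed simp

lemma coef_pos:
  assumes "s \<in> V" "t \<in> V" "s \<noteq> t" "m s t \<noteq> 2" shows "0 < coef s t"
proof (cases "m s t")
  case (enat n)
  have "n \<noteq> 2" using assms(4) enat by (simp add: numeral_eq_enat)
  then have "2 < n" using coef_edge(1)[OF enat assms(1-3)] by simp
  then have "pi / real n < pi / 2" by (intro divide_strict_left_mono) auto
  then have "0 < cos (pi / real n)" using \<open>2 < n\<close> by (intro cos_gt_zero) auto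
  then show ?thesis using coef_edge(2)[OF enat assms(1-3)] by simp
qed (simp add: coef_def)

text \<open>Both sides of \<open>a u = u b\<close> act on the pair \<open>(1, 1)\<close>. The left side leaves \<open>a\<close> in the second
  component and the right side leaves \<open>1\<close>.\<close>

lemma std_parabolic_meets_conjugate_trivially:
  assumes u: "u \<in> V" "u \<notin> T" and far: "\<And>t. t \<in> T \<Longrightarrow> m u t \<noteq> 2"
    and a: "a \<in> std_parabolic V m T" and b: "b \<in> std_parabolic V m T"
    and eq: "a \<otimes>\<^bsub>G\<^esub> gen u = gen u \<otimes>\<^bsub>G\<^esub> b"
  shows "a = \<one>\<^bsub>G\<^esub>"
proof -
  interpret G: group G by (rule group_G)
  obtain v w where v: "v \<in> words T" "a = cls v" and w: "w \<in> words T" "b = cls w"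
    using std_parabolic_word[OF a] std_parabolic_word[OF b] by blast
  have V: "v \<in> words V" "w \<in> words V" "[(u, True)] \<in> words V"
    using v w u T_subset by (auto simp: words_def)
  have "cls (v @ [(u, True)]) = cls ([(u, True)] @ w)"
    unfolding cls_append[OF V(1,3)] cls_append[OF V(3,2)] cls_gen using eq unfolding v(2) w(2) .
  then have rel: "(v @ [(u, True)], [(u, True)] @ w) \<in> pres_rel V (artin_rels V m)"
  proof -
    have "v @ [(u, True)] \<in> words V" "[(u, True)] @ w \<in> words V" using V by (simp_all add: words_def)
    from cls_eq_iff[OF this] show ?thesis
      using \<open>cls (v @ [(u, True)]) = cls ([(u, True)] @ w)\<close> by blast
  qed
  have nw: "\<nexists>t. wall id u t" using u(2) by (auto simp: wall_def)
  have step_u: "step (u, True) (id, c) = (reflect u, c)" for c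
    using step_no_wall[OF nw] by simp
  have "run v (id, \<one>\<^bsub>G\<^esub>) = (id, a)"
    using run_id[OF v(1) G.one_closed] v(2) cls_carrier[OF V(1)] by simp
  then have "a = snd (run (v @ [(u, True)]) (id, \<one>\<^bsub>G\<^esub>))"
    by (simp add: step_u)
  also have "\<dots> = snd (run ([(u, True)] @ w) (id, \<one>\<^bsub>G\<^esub>))"
    unfolding run_pres_rel[OF rel id_chambers G.one_closed] ..
  also have "\<dots> = snd (run w (reflect u, \<one>\<^bsub>G\<^esub>))" by (simp add: step_u)
  also have "\<dots> = \<one>\<^bsub>G\<^esub>"
  proof (rule run_away[OF w(1) u(2)])
    fix t assume t: "t \<in> T"
    then have tV: "t \<in> V" "u \<noteq> t" using T_subset u by auto
    show "reflect u (simple_root t) u \<noteq> 0"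
      unfolding reflect_root_other[OF tV] using coef_pos[OF u(1) tV far[OF t]] tV(2)
      by (simp add: simple_root_def)
  qed
  finally show ?thesis .
qed

end

lemma (in group) mem_conj_subset:
  assumes "g \<in> carrier G" "H \<subseteq> carrier G"
  shows "x \<in> conj_subset G g H \<longleftrightarrow> (\<exists>h\<in>H. x = g \<otimes> h \<otimes> inv g)"
  using assms unfolding conj_subset_def l_coset_def r_coset_def
  by (auto simp: m_assoc subset_iff)

lemma (in group) conj_subset_carrier:
  assumes g: "g \<in> carrier G" shows "conj_subset G g (carrier G) = carrier G"
proof
  show "conj_subset G g (carrier G) \<subseteq> carrier G"
    using g by (auto simp: mem_conj_subset)
  show "carrier G \<subseteq> conj_subset G g (carrier G)"
  proof
    fix x assume x: "x \<in> carrier G"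
    have "g \<otimes> (inv g \<otimes> x \<otimes> g) \<otimes> inv g = (g \<otimes> inv g) \<otimes> x \<otimes> (g \<otimes> inv g)"
      using x g by (simp only: m_assoc m_closed inv_closed)
    then have "x = g \<otimes> (inv g \<otimes> x \<otimes> g) \<otimes> inv g" using x g by simp
    moreover have "inv g \<otimes> x \<otimes> g \<in> carrier G" using x g by simp
    ultimately show "x \<in> conj_subset G g (carrier G)"
      unfolding mem_conj_subset[OF g subset_refl] ..
  qed
qed

theorem theorem1p3:
  fixes V :: "'a set" and m :: "'a \<Rightarrow> 'a \<Rightarrow> enat" and P :: "'a word set set"
  assumes "artin_labels V m"
    and "locally_reducible V m"
    and "card (hat_components V m) \<ge> 2"
    and "parabolic V m P"
    and "\<exists>Q. two_completion V m P Q \<and> Q \<noteq> carrier (artin_group V m)"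
  shows "weakly_malnormal (artin_group V m) P"
proof -
  let ?G = "artin_group V m"
  interpret artin_graph V m by standard (rule assms(1))
  obtain k C where k: "k \<in> carrier ?G" and C: "C \<subseteq> hat_components V m"
    and PQ: "P \<subseteq> conj_subset ?G k (std_parabolic V m (\<Union>C))"
    and Q: "conj_subset ?G k (std_parabolic V m (\<Union>C)) \<noteq> carrier ?G"
    using assms(5) unfolding two_completion_def two_complete_def by blast
  define T where "T = \<Union>C"
  have hat_V: "(s, t) \<in> (hat_edges V m)\<^sup>* \<Longrightarrow> s \<in> V \<Longrightarrow> t \<in> V" for s t
    by (induction rule: rtrancl_induct) (auto simp: hat_edges_def edges_def)
  have TV: "T \<subseteq> V"
    using C hat_V unfolding T_def hat_components_def quotient_def by blast
  interpret artin_parabolic V m T by standard (rule TV)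
  interpret G: group G by (rule group_G)
  let ?A = "std_parabolic V m T"
  have A: "?A \<subseteq> carrier G"
    unfolding std_parabolic_def using TV gen_carrier by (intro G.generate_incl) blast
  \<comment> \<open>Otherwise the 2-completion would be the whole group.\<close>
  have "T \<noteq> V"
  proof
    assume T: "T = V"
    have "cls w \<in> ?A" if "w \<in> words V" for w
      using that
    proof (induction w)
      case Nil
      show ?case unfolding cls_Nil std_parabolic_def by (rule generate.one)
    next
      case (Cons l w)
      obtain s b where l: "l = (s, b)" by (cases l)
      have s: "s \<in> V" and w: "w \<in> words V" using Cons.prems by (auto simp: words_def l)
      have "letter s b \<in> ?A"
        using s unfolding letter_def std_parabolic_def T by (simp add: generate.incl generate.inv)
      then have "letter s b \<otimes>\<^bsub>?G\<^esub> cls w \<in> ?A"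
        using Cons.IH[OF w] unfolding std_parabolic_def by (rule generate.eng)
      also have "letter s b \<otimes>\<^bsub>?G\<^esub> cls w = cls (l # w)"
        using cls_append[of "[(s, b)]" w] cls_letter[OF s] s w by (simp add: l words_def)
      finally show ?case .
    qed
    then have all: "?A = carrier ?G"
      using A unfolding artin_group_def presented_group_def cls_def by (auto simp: quotient_def)
    then show False using Q G.conj_subset_carrier[OF k] unfolding T_def by simp
  qed
  then obtain u where u: "u \<in> V" "u \<notin> T" using TV by blast
  have far: "m u t \<noteq> 2" if t: "t \<in> T" for t
  proof
    assume two: "m u t = 2"
    have tV: "t \<in> V" "t \<noteq> u" using t TV u by auto
    then have "(t, u) \<in> hat_edges V m"
      using u(1) two m_sym[OF u(1) tV(1)] by (simp add: hat_edges_def edges_def numeral_eq_enat)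
    moreover obtain D v where D: "D \<in> C" "t \<in> D" "D = (hat_edges V m)\<^sup>* `` {v}"
      using t C unfolding T_def hat_components_def quotient_def by blast
    ultimately have "u \<in> D" by (auto intro: rtrancl_into_rtrancl)
    then show False using D(1) u(2) unfolding T_def by blast
  qed
  \<comment> \<open>Conjugating by \<open>k\<close> transports the generator \<open>u\<close> to the conjugator for \<open>P\<close>.\<close>
  define w where "w = gen u"
  have w: "w \<in> carrier ?G" unfolding w_def by (rule gen_carrier[OF u(1)])
  define h where "h = k \<otimes>\<^bsub>?G\<^esub> w \<otimes>\<^bsub>?G\<^esub> inv\<^bsub>?G\<^esub> k"
  have h: "h \<in> carrier ?G" unfolding h_def using k w by simp
  have P: "\<exists>a\<in>?A. x = k \<otimes>\<^bsub>?G\<^esub> a \<otimes>\<^bsub>?G\<^esub> inv\<^bsub>?G\<^esub> k" if "x \<in> P" for x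
  proof -
    have "x \<in> conj_subset ?G k ?A" using PQ that unfolding T_def by (rule subsetD)
    then show ?thesis by (simp only: G.mem_conj_subset[OF k A])
  qed
  have P_carrier: "P \<subseteq> carrier ?G"
  proof
    fix x assume "x \<in> P"
    from P[OF this] obtain a where "a \<in> ?A" "x = k \<otimes>\<^bsub>?G\<^esub> a \<otimes>\<^bsub>?G\<^esub> inv\<^bsub>?G\<^esub> k" ..
    then show "x \<in> carrier ?G" using A k by (simp add: subsetD)
  qed
  have "x = \<one>\<^bsub>?G\<^esub>" if x: "x \<in> P" "x \<in> conj_subset ?G h P" for x
  proof -
    obtain p where p: "p \<in> P" "x = h \<otimes>\<^bsub>?G\<^esub> p \<otimes>\<^bsub>?G\<^esub> inv\<^bsub>?G\<^esub> h"
      using x(2) unfolding G.mem_conj_subset[OF h P_carrier] ..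
    obtain a where a: "a \<in> ?A" "x = k \<otimes>\<^bsub>?G\<^esub> a \<otimes>\<^bsub>?G\<^esub> inv\<^bsub>?G\<^esub> k" using P[OF x(1)] ..
    obtain b where b: "b \<in> ?A" "p = k \<otimes>\<^bsub>?G\<^esub> b \<otimes>\<^bsub>?G\<^esub> inv\<^bsub>?G\<^esub> k" using P[OF p(1)] ..
    have ab: "a \<in> carrier ?G" "b \<in> carrier ?G" using a(1) b(1) A by auto
    have cancel: "inv\<^bsub>?G\<^esub> k \<otimes>\<^bsub>?G\<^esub> (k \<otimes>\<^bsub>?G\<^esub> z) = z" if "z \<in> carrier ?G" for z
      using that k by (simp flip: G.m_assoc)
    have "x = k \<otimes>\<^bsub>?G\<^esub> (w \<otimes>\<^bsub>?G\<^esub> b \<otimes>\<^bsub>?G\<^esub> inv\<^bsub>?G\<^esub> w) \<otimes>\<^bsub>?G\<^esub> inv\<^bsub>?G\<^esub> k"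
      unfolding p(2) b(2) h_def using k w ab by (simp add: G.m_assoc G.inv_mult_group cancel)
    then have "k \<otimes>\<^bsub>?G\<^esub> a \<otimes>\<^bsub>?G\<^esub> inv\<^bsub>?G\<^esub> k
        = k \<otimes>\<^bsub>?G\<^esub> (w \<otimes>\<^bsub>?G\<^esub> b \<otimes>\<^bsub>?G\<^esub> inv\<^bsub>?G\<^esub> w) \<otimes>\<^bsub>?G\<^esub> inv\<^bsub>?G\<^esub> k"
      by (simp only: a(2))
    then have "a = w \<otimes>\<^bsub>?G\<^esub> b \<otimes>\<^bsub>?G\<^esub> inv\<^bsub>?G\<^esub> w"
      using k w ab by (simp add: G.right_cancel)
    then have eq: "a \<otimes>\<^bsub>?G\<^esub> gen u = gen u \<otimes>\<^bsub>?G\<^esub> b"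
      using w ab unfolding w_def by (simp add: G.m_assoc)
    have "a = \<one>\<^bsub>?G\<^esub>"
      by (rule std_parabolic_meets_conjugate_trivially[OF u _ a(1) b(1) eq]) (rule far)
    then show ?thesis using a(2) k by simp
  qed
  then have "P \<inter> conj_subset ?G h P \<subseteq> {\<one>\<^bsub>?G\<^esub>}" by blast
  then have "finite (P \<inter> conj_subset ?G h P)" by (rule finite_subset) simp
  then show ?thesis unfolding weakly_malnormal_def using h by blast
qed

end
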